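(* Let $f:\{0,1\}^n\setminus\{\underline{\mathbf 0}\}\to\{0,1\}$ be a (punctured) Boolean function. Then $\gamma(f)=\sum_{J\subset\{1,\dots,n\}} b^*\big(|\Sigma(f)|,\,|\Sigma(f)|\cap|\partial_J\Delta|\big)$.
   Context: $\underline{\mathbf 0}=(0,\dots,0)$. For $x\in\{0,1\}^n$ let $Z_x=\{z\in\mathbb R^n: z_i\ne0\iff x_i=1\}$; $Z(f)=\bigcup\{Z_x: x\neq\underline{\mathbf 0},\ f(x)=1\}$ and $\gamma(f)=\sum_{i\ge0}\dim_{\mathbb Q}H_i(Z(f);\mathbb Q)$. $\Delta=\{x\in\mathbb R^n: x_i\ge0,\ \sum x_i=1\}$ is the standard $(n-1)$-simplex with vertices the standard basis vectors $e_1,\dots,e_n$; for $j\in[n]$ its facet is $\partial_j\Delta=\Delta\cap\{x_j=0\}$, and for $J\subset[n]$, $\partial_J\Delta=\bigcup_{j\in J}\partial_j\Delta$ (empty if $J=\emptyset$). Let $\Delta'$ be the barycentric subdivision of $\Delta$; each nonzero $h\in\{0,1\}^n$ corresponds to the vertex of $\Delta'$ which is the barycenter of the face spanned by $\{e_j: h_j=1\}$, and the simplices of $\Delta'$ correspond to chains $h^{(0)}<\dots<h^{(k)}$ of nonzero vectors in the coordinatewise order. $\Sigma(f)$ is the full subcomplex of $\Delta'$ spanned by the vertices corresponding to $h$ with $f(h)=1$, and $|\Sigma(f)|\subset\Delta$ its geometric realization. For a pair of spaces $B\subset A$, $b^*(A,B)=\sum_{i\ge0}\dim_{\mathbb Q}H_i(A,B;\mathbb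 Q)$. *)

theory Defs
  imports "HOL-Analysis.Analysis" "HOL-Algebra.Module" "HOL-Algebra.AbelCoset" "HOL-Homology.Homology"
begin

section \<open>Quotient modules and dimension\<close>

text \<open>The multiplicative fields \<open>mult\<close>, \<open>one\<close> of a module record play no role in the
  locale \<open>Module.module\<close> and are left undefined.\<close>

definition quotient_module :: "('r, 'b) module \<Rightarrow> 'b set \<Rightarrow> ('r, 'b set) module" where
  "quotient_module M N =
     \<lparr>carrier = A_RCOSETS M N, mult = undefined, one = undefined, ring.zero = N,
      add = (\<lambda>A B. A <+>\<^bsub>M\<^esub> B),
      smult = (\<lambda>q A. ((\<lambda>x. q \<odot>\<^bsub>M\<^esub> x) ` A) <+>\<^bsub>M\<^esub> N)\<rparr>"

lemma quotient_module_smult_rcoset: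
  assumes "Module.module R M" and "submodule N R M"
    and "q \<in> carrier R" and x: "x \<in> carrier M"
  shows "q \<odot>\<^bsub>quotient_module M N\<^esub> (N +>\<^bsub>M\<^esub> x) = N +>\<^bsub>M\<^esub> (q \<odot>\<^bsub>M\<^esub> x)"
proof -
  interpret Module.module R M by fact
  interpret N: submodule N R M by fact
  have NM: "N \<subseteq> carrier M" using N.subset by simp
  have zN: "\<zero>\<^bsub>M\<^esub> \<in> N" using N.one_closed by simp
  have addN: "a \<oplus>\<^bsub>M\<^esub> b \<in> N" if "a \<in> N" "b \<in> N" for a b
    using N.m_closed that by simp
  have 1: "(q \<odot>\<^bsub>M\<^esub> (h \<oplus>\<^bsub>M\<^esub> x)) \<oplus>\<^bsub>M\<^esub> h' = ((q \<odot>\<^bsub>M\<^esub> h) \<oplus>\<^bsub>M\<^esub> h') \<oplus>\<^bsub>M\<^esub> (q \<odot>\<^bsub>M\<^esub> x)"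
    if "h \<in> N" "h' \<in> N" for h h'
  proof -
    have "h \<in> carrier M" "h' \<in> carrier M" using NM that by auto
    then show ?thesis using assms(3) x by (simp add: smult_r_distr M.a_ac)
  qed
  have 2: "(q \<odot>\<^bsub>M\<^esub> h) \<oplus>\<^bsub>M\<^esub> h' \<in> N" if "h \<in> N" "h' \<in> N" for h h'
    using N.smult_closed[OF assms(3) that(1)] that(2) addN by blast
  have 3: "h' = (q \<odot>\<^bsub>M\<^esub> \<zero>\<^bsub>M\<^esub>) \<oplus>\<^bsub>M\<^esub> h'" if "h' \<in> N" for h'
  proof -
    have "h' \<in> carrier M" using NM that by auto
    then show ?thesis using assms(3) smult_r_null by simp
  qed
  have "(\<Union>y\<in>(\<lambda>y. q \<odot>\<^bsub>M\<^esub> y) ` (\<Union>h\<in>N. {h \<oplus>\<^bsub>M\<^esub> x}). \<Union>h\<in>N. {y \<oplus>\<^bsub>M\<^esub> h})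
      = (\<Union>h\<in>N. {h \<oplus>\<^bsub>M\<^esub> (q \<odot>\<^bsub>M\<^esub> x)})" (is "?L = ?R")
  proof
    show "?L \<subseteq> ?R" using 1 2 by fastforce
    show "?R \<subseteq> ?L"
    proof
      fix z assume "z \<in> ?R"
      then obtain h where h: "h \<in> N" "z = h \<oplus>\<^bsub>M\<^esub> (q \<odot>\<^bsub>M\<^esub> x)" by auto
      then have "z = (q \<odot>\<^bsub>M\<^esub> (\<zero>\<^bsub>M\<^esub> \<oplus>\<^bsub>M\<^esub> x)) \<oplus>\<^bsub>M\<^esub> h" using 1[OF zN h(1)] 3[OF h(1)] by simp
      then show "z \<in> ?L" using zN h(1) by blast
    qed
  qed
  then show ?thesis
    by (simp add: quotient_module_def set_add_def' a_r_coset_def')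
qed

lemma module_quotient_module:
  assumes "Module.module R M" and "submodule N R M"
  shows "Module.module R (quotient_module M N)"
proof -
  interpret Module.module R M by fact
  interpret N: submodule N R M by fact
  interpret AN: abelian_subgroup N M
    by (intro abelian_subgroupI3 additive_subgroup.intro N.subgroup_axioms) unfold_locales
  let ?Q = "quotient_module M N"
  have car: "carrier ?Q = {N +>\<^bsub>M\<^esub> x | x. x \<in> carrier M}"
    by (auto simp: quotient_module_def A_RCOSETS_def')
  have addQ: "(N +>\<^bsub>M\<^esub> x) \<oplus>\<^bsub>?Q\<^esub> (N +>\<^bsub>M\<^esub> y) = N +>\<^bsub>M\<^esub> (x \<oplus>\<^bsub>M\<^esub> y)"
    if "x \<in> carrier M" "y \<in> carrier M" for x y
    using that by (simp add: quotient_module_def AN.a_rcos_sum)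
  have zeroQ: "\<zero>\<^bsub>?Q\<^esub> = N +>\<^bsub>M\<^esub> \<zero>\<^bsub>M\<^esub>"
    by (simp add: quotient_module_def AN.a_subset M.a_coset_add_zero)
  note smultQ = quotient_module_smult_rcoset[OF assms]
  show ?thesis
  proof (rule moduleI)
    show "cring R" by unfold_locales
    show "abelian_group ?Q"
    proof (rule abelian_groupI)
      fix x assume "x \<in> carrier ?Q"
      then obtain a where a: "a \<in> carrier M" "x = N +>\<^bsub>M\<^esub> a" using car by auto
      then have "(N +>\<^bsub>M\<^esub> (\<ominus>\<^bsub>M\<^esub> a)) \<oplus>\<^bsub>?Q\<^esub> x = \<zero>\<^bsub>?Q\<^esub>"
        using addQ zeroQ by (simp add: M.l_neg)
      then show "\<exists>y\<in>carrier ?Q. y \<oplus>\<^bsub>?Q\<^esub> x = \<zero>\<^bsub>?Q\<^esub>"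
        using a by (intro bexI) (auto simp: car)
    qed (auto simp: car addQ zeroQ M.a_assoc intro: M.a_comm, auto simp: M.a_comm)
  qed (auto simp: car addQ smultQ smult_l_distr smult_r_distr smult_assoc1)
qed

definition finite_basis :: "('r, 'm) ring_scheme \<Rightarrow> ('r, 'b, 'k) module_scheme \<Rightarrow> 'b set \<Rightarrow> bool" where
  "finite_basis R M B \<longleftrightarrow>
     finite B \<and> B \<subseteq> carrier M \<and>
     (\<forall>a \<in> B \<rightarrow> carrier R. (\<Oplus>\<^bsub>M\<^esub>v\<in>B. a v \<odot>\<^bsub>M\<^esub> v) = \<zero>\<^bsub>M\<^esub> \<longrightarrow> (\<forall>v\<in>B. a v = \<zero>\<^bsub>R\<^esub>)) \<and>
     (\<forall>x \<in> carrier M. \<exists>a \<in> B \<rightarrow> carrier R. x = (\<Oplus>\<^bsub>M\<^esub>v\<in>B. a v \<odot>\<^bsub>M\<^esub> v))"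

text \<open>The dimension of a vector space \<open>M\<close> over a field \<open>R\<close>, with value \<open>\<infinity>\<close> if there is no
  finite basis.\<close>

definition vdim :: "('r, 'm) ring_scheme \<Rightarrow> ('r, 'b, 'k) module_scheme \<Rightarrow> enat" where
  "vdim R M = (if \<exists>B. finite_basis R M B then enat (card (SOME B. finite_basis R M B)) else \<infinity>)"

section \<open>Singular homology with rational coefficients\<close>

text \<open>HOL-Homology treats integer coefficients only. Its singular simplices and faces are reused;
  the definitions below follow \<open>singular_chain\<close>, \<open>chain_boundary\<close>, \<open>singular_relcycle\<close> and
  \<open>singular_relboundary\<close> with \<open>int\<close> replaced by \<open>rat\<close>.\<close>

definition rat_ring :: "rat ring" where
  "rat_ring = \<lparr>carrier = UNIV, mult = (*), one = 1, ring.zero = 0, add = (+)\<rparr>"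

lemma field_rat_ring: "Ring.field rat_ring"
proof (rule cring.cring_fieldI)
  show "cring rat_ring"
    by (rule cringI, rule abelian_groupI, unfold comm_monoid_def comm_monoid_axioms_def monoid_def)
      (auto simp: rat_ring_def algebra_simps intro: exI[of _ "- x" for x]
         ab_group_add_class.ab_left_minus)
  show "Units rat_ring = carrier rat_ring - {\<zero>\<^bsub>rat_ring\<^esub>}"
  proof -
    have "\<exists>y. y * x = 1 \<and> x * y = 1" if "x \<noteq> 0" for x :: rat
      using that by (intro exI[of _ "inverse x"]) simp
    then show ?thesis by (auto simp: Units_def rat_ring_def)
  qed
qed

type_synonym 'a rchain = "((nat \<Rightarrow> real) \<Rightarrow> 'a) \<Rightarrow>\<^sub>0 rat"

definition rchain_scale :: "rat \<Rightarrow> 'a rchain \<Rightarrow> 'a rchain" where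
  "rchain_scale q c = Poly_Mapping.map ((*) q) c"

definition rchain_module :: "(rat, 'a rchain) module" where
  "rchain_module =
     \<lparr>carrier = UNIV, mult = undefined, one = undefined, ring.zero = 0, add = (+),
      smult = rchain_scale\<rparr>"

definition singular_rchain :: "nat \<Rightarrow> 'a topology \<Rightarrow> 'a rchain \<Rightarrow> bool" where
  "singular_rchain p X c \<longleftrightarrow> Poly_Mapping.keys c \<subseteq> singular_simplex_set p X"

definition rchain_boundary :: "nat \<Rightarrow> 'a rchain \<Rightarrow> 'a rchain" where
  "rchain_boundary p c =
     (if p = 0 then 0
      else \<Sum>s\<in>Poly_Mapping.keys c. \<Sum>k\<le>p.
             Poly_Mapping.single (singular_face p k s) ((-1) ^ k * Poly_Mapping.lookup c s))"

definition rat_relcycles :: "nat \<Rightarrow> 'a topology \<Rightarrow> 'a set \<Rightarrow> 'a rchain set" where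
  "rat_relcycles p X S =
     {c. singular_rchain p X c \<and> singular_rchain (p - 1) (subtopology X S) (rchain_boundary p c)}"

definition rat_relboundaries :: "nat \<Rightarrow> 'a topology \<Rightarrow> 'a set \<Rightarrow> 'a rchain set" where
  "rat_relboundaries p X S =
     {c. \<exists>d. singular_rchain (Suc p) X d \<and>
             singular_rchain p (subtopology X S) (rchain_boundary (Suc p) d - c)}"

definition rat_relative_homology :: "nat \<Rightarrow> 'a topology \<Rightarrow> 'a set \<Rightarrow> (rat, 'a rchain set) module" where
  "rat_relative_homology p X S =
     quotient_module (rchain_module\<lparr>carrier := rat_relcycles p X S\<rparr>) (rat_relboundaries p X S)"

abbreviation rat_homology :: "nat \<Rightarrow> 'a topology \<Rightarrow> (rat, 'a rchain set) module" where
  "rat_homology p X \<equiv> rat_relative_homology p X {}"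

subsection \<open>Rational relative homology is a vector space\<close>

lemma lookup_rchain_scale [simp]:
  "Poly_Mapping.lookup (rchain_scale q c) s = q * Poly_Mapping.lookup c s"
  by (simp add: rchain_scale_def Poly_Mapping.map.rep_eq when_def)

lemma keys_rchain_scale: "Poly_Mapping.keys (rchain_scale q c) \<subseteq> Poly_Mapping.keys c"
  by (auto simp: in_keys_iff)

lemma rchain_boundary_superset:
  assumes "finite T" and "Poly_Mapping.keys c \<subseteq> T" and "p \<noteq> 0"
  shows "rchain_boundary p c = (\<Sum>s\<in>T. \<Sum>k\<le>p.
    Poly_Mapping.single (singular_face p k s) ((-1) ^ k * Poly_Mapping.lookup c s))"
  using assms unfolding rchain_boundary_def
  by (auto intro!: sum.mono_neutral_left simp: in_keys_iff)

lemma rchain_boundary_add: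
  "rchain_boundary p (c + d) = rchain_boundary p c + rchain_boundary p d"
proof (cases "p = 0")
  case False
  let ?T = "Poly_Mapping.keys c \<union> Poly_Mapping.keys d"
  have "Poly_Mapping.keys (c + d) \<subseteq> ?T" by (rule Poly_Mapping.keys_add)
  then show ?thesis
    using False by (simp add: rchain_boundary_superset[of ?T] lookup_add distrib_left single_add sum.distrib)
qed (simp add: rchain_boundary_def)

lemma rchain_scale_add: "rchain_scale q (c + d) = rchain_scale q c + rchain_scale q d"
  by (rule poly_mapping_eqI) (simp add: lookup_add algebra_simps)

lemma rchain_scale_sum: "rchain_scale q (sum g A) = (\<Sum>x\<in>A. rchain_scale q (g x))"
proof (induction A rule: infinite_finite_induct)
  case (insert x F)
  then show ?case by (simp add: rchain_scale_add)
qed (auto intro: poly_mapping_eqI)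

lemma rchain_scale_single:
  "rchain_scale q (Poly_Mapping.single s r) = Poly_Mapping.single s (q * r)"
  by (rule poly_mapping_eqI) (simp add: lookup_single when_def)

lemma rchain_boundary_scale:
  "rchain_boundary p (rchain_scale q c) = rchain_scale q (rchain_boundary p c)"
proof (cases "p = 0")
  case True
  then show ?thesis by (auto simp: rchain_boundary_def intro: poly_mapping_eqI)
next
  case False
  then show ?thesis
    by (simp add: rchain_boundary_superset[of "Poly_Mapping.keys c"] keys_rchain_scale
        rchain_scale_sum rchain_scale_single mult.left_commute)
qed

lemma singular_rchain_0 [simp]: "singular_rchain p X 0"
  by (simp add: singular_rchain_def)

lemma singular_rchain_add:
  "singular_rchain p X c \<Longrightarrow> singular_rchain p X d \<Longrightarrow> singular_rchain p X (c + d)"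
  using Poly_Mapping.keys_add[of c d] by (auto simp: singular_rchain_def)

lemma singular_rchain_scale: "singular_rchain p X c \<Longrightarrow> singular_rchain p X (rchain_scale q c)"
  using keys_rchain_scale[of q c] by (auto simp: singular_rchain_def)

lemma singular_rchain_diff:
  "singular_rchain p X c \<Longrightarrow> singular_rchain p X d \<Longrightarrow> singular_rchain p X (c - d)"
  using keys_diff[of c d] by (auto simp: singular_rchain_def)


definition rchain_of_chain :: "'a chain \<Rightarrow> 'a rchain" where
  "rchain_of_chain c = Poly_Mapping.map of_int c"

lemma lookup_rchain_of_chain [simp]:
  "Poly_Mapping.lookup (rchain_of_chain c) s = of_int (Poly_Mapping.lookup c s)"
  by (simp add: rchain_of_chain_def Poly_Mapping.map.rep_eq when_def)

lemma keys_rchain_of_chain [simp]: "Poly_Mapping.keys (rchain_of_chain c) = Poly_Mapping.keys c"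
  by (auto simp: in_keys_iff)

lemma rchain_of_chain_add: "rchain_of_chain (c + d) = rchain_of_chain c + rchain_of_chain d"
  by (rule poly_mapping_eqI) (simp add: lookup_add)

lemma rchain_of_chain_sum: "rchain_of_chain (sum g A) = (\<Sum>x\<in>A. rchain_of_chain (g x))"
proof (induction A rule: infinite_finite_induct)
  case (insert x F)
  then show ?case by (simp add: rchain_of_chain_add)
qed (auto intro: poly_mapping_eqI)

lemma rchain_boundary_of_chain:
  "rchain_boundary p (rchain_of_chain c) = rchain_of_chain (chain_boundary p c)"
proof (cases "p = 0")
  case True
  then show ?thesis
    by (auto simp: rchain_boundary_def chain_boundary_def intro: poly_mapping_eqI)
next
  case False
  have *: "rchain_of_chain (frag_cmul a (frag_cmul b (frag_of t))) = Poly_Mapping.single t (of_int (b * a))"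
    for a b :: int and t :: "(nat \<Rightarrow> real) \<Rightarrow> 'a"
    by (rule poly_mapping_eqI) (auto simp: lookup_single when_def)
  from False show ?thesis
    by (simp add: rchain_boundary_def chain_boundary_def frag_extend_def frag_cmul_sum
        rchain_of_chain_sum * del: frag_cmul_cmul)
qed

lemma rchain_boundary_sum: "rchain_boundary p (sum g A) = (\<Sum>x\<in>A. rchain_boundary p (g x))"
proof (induction A rule: infinite_finite_induct)
  case (insert x F)
  then show ?case by (simp add: rchain_boundary_add)
qed (auto simp: rchain_boundary_def)

lemma rchain_expansion:
  "c = (\<Sum>s\<in>Poly_Mapping.keys c. rchain_scale (Poly_Mapping.lookup c s) (rchain_of_chain (frag_of s)))"
  by (rule poly_mapping_eqI) (auto simp: lookup_sum in_keys_iff if_distrib sum.delta cong: if_cong)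

lemma rchain_boundary_boundary:
  assumes "singular_rchain p X c"
  shows "rchain_boundary (p - 1) (rchain_boundary p c) = 0"
proof -
  have "rchain_boundary (p - 1) (rchain_boundary p (rchain_of_chain (frag_of s))) = 0"
    if "s \<in> Poly_Mapping.keys c" for s
  proof -
    have "singular_chain p X (frag_of s)"
      using assms that by (auto simp: singular_rchain_def singular_chain_of)
    then have "chain_boundary (p - 1) (chain_boundary p (frag_of s)) = 0"
      by (simp add: chain_boundary_boundary)
    then show ?thesis
      by (simp add: rchain_boundary_of_chain) (auto intro: poly_mapping_eqI)
  qed
  moreover have "rchain_scale q 0 = (0 :: 'a rchain)" for q
    by (rule poly_mapping_eqI) simp
  ultimately show ?thesis
    by (subst rchain_expansion[of c]) (simp add: rchain_boundary_sum rchain_boundary_scale)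
qed

lemma singular_rchain_boundary:
  assumes "singular_rchain p X c"
  shows "singular_rchain (p - 1) X (rchain_boundary p c)"
proof -
  have sum: "singular_rchain q X (sum g A)" if "\<And>x. x \<in> A \<Longrightarrow> singular_rchain q X (g x)"
    for q A and g :: "'b \<Rightarrow> 'a rchain"
    using that by (induction A rule: infinite_finite_induct) (auto intro: singular_rchain_add)
  have "singular_rchain (p - 1) X (rchain_of_chain (chain_boundary p (frag_of s)))"
    if "s \<in> Poly_Mapping.keys c" for s
  proof -
    have "singular_chain p X (frag_of s)"
      using assms that by (auto simp: singular_rchain_def singular_chain_of)
    then show ?thesis
      using singular_chain_boundary[of p X] by (auto simp: singular_rchain_def singular_chain_def)
  qed
  then show ?thesis
    by (subst rchain_expansion[of c])
      (auto simp: rchain_boundary_sum rchain_boundary_scale rchain_boundary_of_chain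
        intro!: sum singular_rchain_scale)
qed

lemma rat_relboundaries_subset: "rat_relboundaries p X S \<subseteq> rat_relcycles p X S"
proof
  fix c assume "c \<in> rat_relboundaries p X S"
  then obtain d where d: "singular_rchain (Suc p) X d"
    and cd: "singular_rchain p (subtopology X S) (rchain_boundary (Suc p) d - c)"
    by (auto simp: rat_relboundaries_def)
  define e where "e = rchain_boundary (Suc p) d - c"
  have e: "singular_rchain p (subtopology X S) e" using cd by (simp add: e_def)
  have eX: "singular_rchain p X e"
    using e by (auto simp: singular_rchain_def singular_simplex_subtopology)
  have bd: "singular_rchain p X (rchain_boundary (Suc p) d)"
    using singular_rchain_boundary[OF d] by simp
  have c: "c = rchain_boundary (Suc p) d + rchain_scale (-1) e"
    by (rule poly_mapping_eqI) (simp add: e_def lookup_add lookup_minus)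
  have "rchain_boundary p c = rchain_scale (-1) (rchain_boundary p e)"
    using rchain_boundary_boundary[OF d] by (simp add: c rchain_boundary_add rchain_boundary_scale)
  moreover have "singular_rchain p X c"
    unfolding c using bd eX by (intro singular_rchain_add singular_rchain_scale)
  ultimately show "c \<in> rat_relcycles p X S"
    using singular_rchain_boundary[OF e] by (simp add: rat_relcycles_def singular_rchain_scale)
qed

lemma module_rchain_module: "Module.module rat_ring rchain_module"
proof (rule moduleI)
  show "cring rat_ring"
    using field_rat_ring by (simp add: field_def domain_def)
  show "abelian_group (rchain_module :: (rat, 'a rchain) module)"
    by (rule abelian_groupI)
      (auto simp: rchain_module_def add_ac intro: exI[of _ "- x" for x])
qed (auto simp: rchain_module_def rat_ring_def lookup_add algebra_simps intro!: poly_mapping_eqI)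

lemma submodule_rchain_moduleI:
  assumes "0 \<in> N" and "\<And>x y. x \<in> N \<Longrightarrow> y \<in> N \<Longrightarrow> x + y \<in> N"
    and "\<And>q x. x \<in> N \<Longrightarrow> rchain_scale q x \<in> N"
  shows "submodule N rat_ring rchain_module"
proof (rule module.submoduleI[OF module_rchain_module])
  fix x assume "x \<in> N"
  have "\<ominus>\<^bsub>rchain_module\<^esub> x = rchain_scale (-1) x"
  proof -
    interpret M: Module.module rat_ring "rchain_module :: (rat, 'a rchain) module"
      by (rule module_rchain_module)
    have "rchain_scale (-1) x \<oplus>\<^bsub>rchain_module\<^esub> x = \<zero>\<^bsub>rchain_module\<^esub>"
      by (auto simp: rchain_module_def lookup_add intro: poly_mapping_eqI)
    then show ?thesis
      by (intro M.minus_equality) (auto simp: rchain_module_def)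
  qed
  then show "\<ominus>\<^bsub>rchain_module\<^esub> x \<in> N" using assms(3) \<open>x \<in> N\<close> by simp
qed (use assms in \<open>auto simp: rchain_module_def\<close>)

lemma submodule_rat_relcycles: "submodule (rat_relcycles p X S) rat_ring rchain_module"
proof (rule submodule_rchain_moduleI)
  show "0 \<in> rat_relcycles p X S"
    by (simp add: rat_relcycles_def rchain_boundary_def)
qed (simp_all add: rat_relcycles_def rchain_boundary_add rchain_boundary_scale
      singular_rchain_add singular_rchain_scale)

lemma submodule_rat_relboundaries: "submodule (rat_relboundaries p X S) rat_ring rchain_module"
proof (rule submodule_rchain_moduleI)
  show "0 \<in> rat_relboundaries p X S"
    by (auto simp: rat_relboundaries_def rchain_boundary_def intro!: exI[of _ 0])
next
  fix x y assume "x \<in> rat_relboundaries p X S" "y \<in> rat_relboundaries p X S"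
  then obtain d e where
    "singular_rchain (Suc p) X d" "singular_rchain p (subtopology X S) (rchain_boundary (Suc p) d - x)"
    "singular_rchain (Suc p) X e" "singular_rchain p (subtopology X S) (rchain_boundary (Suc p) e - y)"
    by (auto simp: rat_relboundaries_def)
  then show "x + y \<in> rat_relboundaries p X S"
    using singular_rchain_add[of p "subtopology X S" "rchain_boundary (Suc p) d - x"
        "rchain_boundary (Suc p) e - y"]
    by (auto simp: rat_relboundaries_def rchain_boundary_add add_diff_add
        intro!: exI[of _ "d + e"] singular_rchain_add)
next
  fix q x assume "x \<in> rat_relboundaries p X S"
  then obtain d where d:
    "singular_rchain (Suc p) X d" "singular_rchain p (subtopology X S) (rchain_boundary (Suc p) d - x)"
    by (auto simp: rat_relboundaries_def)
  have "rchain_scale q (rchain_boundary (Suc p) d - x)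
      = rchain_boundary (Suc p) (rchain_scale q d) - rchain_scale q x"
    by (rule poly_mapping_eqI) (simp add: rchain_boundary_scale lookup_minus algebra_simps)
  then show "rchain_scale q x \<in> rat_relboundaries p X S"
    using d singular_rchain_scale[OF d(2), of q]
    by (auto simp: rat_relboundaries_def intro!: exI[of _ "rchain_scale q d"] singular_rchain_scale)
qed

lemma module_rat_relative_homology: "Module.module rat_ring (rat_relative_homology p X S)"
proof -
  let ?Z = "rchain_module\<lparr>carrier := rat_relcycles p X S\<rparr>"
  interpret M: Module.module rat_ring "rchain_module :: (rat, 'a rchain) module"
    by (rule module_rchain_module)
  interpret Z: submodule "rat_relcycles p X S" rat_ring rchain_module
    by (rule submodule_rat_relcycles)
  have Z: "Module.module rat_ring ?Z"
    by (rule Z.submodule_is_module[OF module_rchain_module])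
  have "Module.module rat_ring (rchain_module\<lparr>carrier := rat_relboundaries p X S\<rparr>)"
    using submodule.submodule_is_module[OF submodule_rat_relboundaries module_rchain_module] .
  then have "submodule (rat_relboundaries p X S) rat_ring ?Z"
    using module.module_incl_imp_submodule[OF Z, of "rat_relboundaries p X S"]
      rat_relboundaries_subset[of p X S] by simp
  then show ?thesis
    unfolding rat_relative_homology_def by (rule module_quotient_module[OF Z])
qed

subsection \<open>Total Betti numbers\<close>

text \<open>Every series in \<open>enat\<close> converges. Plain \<open>suminf\<close> is written out because
  \<open>HOL-Library.Groups_Big_Fun\<close> makes the summation symbol ambiguous here.\<close>

definition total_betti :: "'a::topological_space set \<Rightarrow> 'a set \<Rightarrow> enat" where
  "total_betti A B = suminf (\<lambda>i. vdim rat_ring (rat_relative_homology i (top_of_set A) B))"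

section \<open>Punctured Boolean functions\<close>

text \<open>The type \<open>'n\<close> plays the role of \<open>{1, \<dots>, n}\<close>, and \<open>'n \<Rightarrow> bool\<close> that of \<open>{0,1}\<^sup>n\<close> (with
  its pointwise order). A punctured Boolean function is represented by
  \<open>f :: ('n \<Rightarrow> bool) \<Rightarrow> bool\<close>; its value at the zero vector \<open>\<lambda>_. False\<close> is never used.\<close>

definition stratum :: "('n::finite \<Rightarrow> bool) \<Rightarrow> (real ^ 'n) set" where
  "stratum x = {z. \<forall>i. z $ i \<noteq> 0 \<longleftrightarrow> x i}"

definition Zset :: "(('n::finite \<Rightarrow> bool) \<Rightarrow> bool) \<Rightarrow> (real ^ 'n) set" where
  "Zset f = (\<Union>x\<in>{x. x \<noteq> (\<lambda>_. False) \<and> f x}. stratum x)"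

definition gamma :: "(('n::finite \<Rightarrow> bool) \<Rightarrow> bool) \<Rightarrow> enat" where
  "gamma f = suminf (\<lambda>i. vdim rat_ring (rat_homology i (top_of_set (Zset f))))"

definition std_simplex :: "(real ^ 'n::finite) set" where
  "std_simplex = {x. (\<forall>i. 0 \<le> x $ i) \<and> (\<Sum>i\<in>UNIV. x $ i) = 1}"

definition facet :: "'n::finite \<Rightarrow> (real ^ 'n) set" where
  "facet j = std_simplex \<inter> {x. x $ j = 0}"

definition facets :: "'n::finite set \<Rightarrow> (real ^ 'n) set" where
  "facets J = (\<Union>j\<in>J. facet j)"

text \<open>A simplex of the barycentric subdivision is represented by the chain of nonzero vectors
  that indexes its vertices.\<close>

definition barycentric_subdivision :: "('n::finite \<Rightarrow> bool) set set" where
  "barycentric_subdivision =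
     {C. C \<noteq> {} \<and> (\<lambda>_. False) \<notin> C \<and> (\<forall>g\<in>C. \<forall>h\<in>C. g \<le> h \<or> h \<le> g)}"

definition Sigma_complex :: "(('n::finite \<Rightarrow> bool) \<Rightarrow> bool) \<Rightarrow> ('n \<Rightarrow> bool) set set" where
  "Sigma_complex f = {C \<in> barycentric_subdivision. C \<subseteq> {h. f h}}"

definition barycenter :: "('n::finite \<Rightarrow> bool) \<Rightarrow> real ^ 'n" where
  "barycenter h = (1 / real (card {j. h j})) *\<^sub>R (\<Sum>j\<in>{j. h j}. axis j 1)"

definition realization :: "('n::finite \<Rightarrow> bool) set set \<Rightarrow> (real ^ 'n) set" where
  "realization K = (\<Union>C\<in>K. convex hull (barycenter ` C))"

end

theory Submission
  imports Defs
begin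

text \<open>
  Identify \<open>f\<close> with a predicate \<open>F\<close> on subsets of the index set and call \<open>H\<close> separated at \<open>z\<close> if
  every \<open>\<bar>z\<^sub>i\<bar>\<close> with \<open>i \<in> H\<close> is nonzero and exceeds all \<open>\<bar>z\<^sub>j\<bar>\<close> with \<open>j \<notin> H\<close>; for \<open>z\<close> in the
  simplex, the separated sets are the vertices of the open simplex of the barycentric subdivision
  containing \<open>z\<close>. Let \<open>U F\<close> be the open set of points with some separated set in \<open>F\<close>, and \<open>C F\<close> the
  set of nonzero points all of whose separated sets are in \<open>F\<close>. Then \<open>C F \<subseteq> Z(f) \<subseteq> U F\<close>, and
  shrinking the barycentric coordinates outside \<open>F\<close> deforms both \<open>U F\<close> and \<open>Z(f)\<close> into \<open>C F\<close>.

  Since \<open>U F\<close> is open and invariant under reflections, it can be folded along one coordinate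
  hyperplane after the other. A retraction splits the homology of a pair, and excision and a
  reflection identify the second summand: folding at \<open>j\<close> replaces a pair by the same pair and the
  pair enlarged by a neighbourhood of \<open>{z\<^sub>j = 0}\<close>, both on the half space \<open>z\<^sub>j \<ge> 0\<close>. Folding
  all coordinates produces one summand for each set \<open>J\<close>, namely the pair of \<open>U F\<close> and \<open>U G\<close> in the
  positive orthant where \<open>G\<close> consists of the members of \<open>F\<close> that do not contain \<open>J\<close>. This pair
  deforms to \<open>(\<bar>\<Sigma>(f)\<bar>, \<bar>\<Sigma>(f)\<bar> \<inter> \<bar>\<partial>\<^sub>J\<Delta>\<bar>)\<close>.

  Excision and homotopy invariance are transferred from integral to rational chains by clearing
  denominators.
\<close>

section \<open>Dimension of a quotient of vector spaces\<close>

definition ecard :: "'a set \<Rightarrow> enat" where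
  "ecard S = (if finite S then enat (card S) else \<infinity>)"

lemma ecard_Un_disjoint: "S \<inter> T = {} \<Longrightarrow> ecard (S \<union> T) = ecard S + ecard T"
  by (simp add: ecard_def card_Un_disjoint)

lemma ecard_image: "inj_on g S \<Longrightarrow> ecard (g ` S) = ecard S"
  by (simp add: ecard_def card_image finite_image_iff)

locale vspace = vector_space scale
  for scale :: "'r::field \<Rightarrow> 'b::ab_group_add \<Rightarrow> 'b"
begin

text \<open>Linear independence of the cosets modulo \<open>N\<close>, expressed through
  representatives. Restricting to finite \<open>T\<close> lets \<open>S\<close> be infinite, and two
  elements of \<open>S\<close> in the same coset are excluded automatically.\<close>

definition indep_mod :: "'b set \<Rightarrow> 'b set \<Rightarrow> bool" where
  "indep_mod N S \<longleftrightarrow>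
     (\<forall>T a. finite T \<longrightarrow> T \<subseteq> S \<longrightarrow> (\<Sum>t\<in>T. scale (a t) t) \<in> N \<longrightarrow> (\<forall>t\<in>T. a t = 0))"

definition basis_mod :: "'b set \<Rightarrow> 'b set \<Rightarrow> 'b set \<Rightarrow> bool" where
  "basis_mod Z N S \<longleftrightarrow> S \<subseteq> Z \<and> indep_mod N S \<and> (\<forall>z\<in>Z. \<exists>x\<in>span S. z - x \<in> N)"

lemma indep_modD:
  "indep_mod N S \<Longrightarrow> finite T \<Longrightarrow> T \<subseteq> S \<Longrightarrow> (\<Sum>t\<in>T. scale (a t) t) \<in> N \<Longrightarrow> t \<in> T \<Longrightarrow> a t = 0"
  unfolding indep_mod_def by blast

text \<open>A basis \<open>K\<close> of \<open>N\<close> extends to a basis \<open>B\<close> of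
  \<open>Z\<close>; the added vectors \<open>B - K\<close> represent a basis of the
  quotient.\<close>

lemma basis_mod_exists:
  assumes "subspace Z" "subspace N" "N \<subseteq> Z"
  obtains S where "basis_mod Z N S"
proof -
  obtain K where K: "K \<subseteq> N" "independent K" "N \<subseteq> span K"
    using maximal_independent_subset by blast
  have spK: "span K = N" using K assms(2) span_minimal by blast
  obtain B where B: "K \<subseteq> B" "B \<subseteq> Z" "independent B" "Z \<subseteq> span B"
    using maximal_independent_subset_extend[of K Z] K assms by blast
  have ind: "indep_mod N (B - K)"
    unfolding indep_mod_def
  proof (intro allI impI ballI, rule ccontr)
    fix T a t assume T: "finite T" "T \<subseteq> B - K" "(\<Sum>t\<in>T. scale (a t) t) \<in> N" "t \<in> T" "a t \<noteq> 0"
    let ?r = "\<Sum>u\<in>T - {t}. scale (a u) u"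
    have "(\<Sum>t\<in>T. scale (a t) t) = scale (a t) t + ?r" using T by (simp add: sum.remove)
    then have eq: "scale (a t) t = (\<Sum>t\<in>T. scale (a t) t) - ?r" by simp
    have "(\<Sum>t\<in>T. scale (a t) t) \<in> span (B - {t})"
      using T spK B span_mono[of K "B - {t}"] by blast
    moreover have "?r \<in> span (B - {t})"
      using T by (intro span_sum span_scale span_base) auto
    ultimately have "scale (a t) t \<in> span (B - {t})" unfolding eq by (rule span_diff)
    then have "t \<in> span (B - {t})" using T span_scale[of "scale (a t) t" _ "inverse (a t)"] by simp
    then show False using B T by (auto simp: dependent_def)
  qed
  have "\<exists>x\<in>span (B - K). z - x \<in> N" if "z \<in> Z" for z
  proof -
    have "K \<union> (B - K) = B" using B by blast
    then have "z \<in> span (K \<union> (B - K))" using that B by auto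
    then obtain k x where "k \<in> span K" "x \<in> span (B - K)" "z = k + x"
      unfolding span_Un by blast
    then show ?thesis using spK by auto
  qed
  then have "basis_mod Z N (B - K)" using ind B by (auto simp: basis_mod_def)
  then show thesis using that by blast
qed

text \<open>Every \<open>t\<close> in \<open>T\<close> is congruent modulo \<open>N\<close> to some
  \<open>x t\<close> in the span of \<open>S\<close>. Independence modulo \<open>N\<close> makes
  \<open>x\<close> injective on \<open>T\<close> with independent image, so the usual bound for
  independent subsets of a span applies.\<close>

lemma indep_mod_card_le:
  assumes N: "subspace N" and S: "basis_mod Z N S" "finite S"
    and T: "finite T" "T \<subseteq> Z" "indep_mod N T"
  shows "card T \<le> card S"
proof -
  have "\<forall>t\<in>T. \<exists>x. x \<in> span S \<and> t - x \<in> N" using S T unfolding basis_mod_def by blast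
  then obtain x where x: "\<And>t. t \<in> T \<Longrightarrow> x t \<in> span S \<and> t - x t \<in> N" by metis
  have rel: "\<forall>t\<in>T. a t = 0" if "(\<Sum>t\<in>T. scale (a t) (x t)) = 0" for a
  proof -
    have "(\<Sum>t\<in>T. scale (a t) (t - x t)) \<in> N"
      using x by (intro subspace_sum[OF N] subspace_scale[OF N]) auto
    then have "(\<Sum>t\<in>T. scale (a t) t) \<in> N"
      using that by (simp add: scale_right_diff_distrib sum_subtractf)
    then show ?thesis using T indep_modD by blast
  qed
  have inj: "inj_on x T"
  proof (rule inj_onI, rule ccontr)
    fix s t assume st: "s \<in> T" "t \<in> T" "x s = x t" "s \<noteq> t"
    let ?a = "\<lambda>u. if u = s then 1 :: 'r else if u = t then - 1 else 0"
    have "(\<Sum>u\<in>T. scale (?a u) (x u)) = (\<Sum>u\<in>{s,t}. scale (?a u) (x u))"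
      using T st by (intro sum.mono_neutral_right) auto
    also have "\<dots> = 0" using st by simp
    finally have "\<forall>u\<in>T. ?a u = 0" by (rule rel)
    then show False using st by auto
  qed
  have "independent (x ` T)"
  proof -
    have "\<forall>v\<in>x ` T. u v = 0" if "(\<Sum>v\<in>x ` T. scale (u v) v) = 0" for u
    proof -
      have "(\<Sum>t\<in>T. scale (u (x t)) (x t)) = 0" using that by (simp add: sum.reindex[OF inj])
      from rel[OF this] show ?thesis by auto
    qed
    then show ?thesis using T by (auto simp: dependent_finite)
  qed
  moreover have "x ` T \<subseteq> span S" using x by auto
  ultimately have "card (x ` T) \<le> card S" using independent_span_bound S(2) by blast
  then show ?thesis by (simp add: card_image inj)
qed

lemma basis_mod_ecard_le:
  assumes N: "subspace N" and S: "basis_mod Z N S" and T: "T \<subseteq> Z" "indep_mod N T"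
  shows "ecard T \<le> ecard S"
proof (cases "finite S")
  case True
  have le: "card U \<le> card S" if "U \<subseteq> T" "finite U" for U
  proof (rule indep_mod_card_le[OF N S True that(2)])
    show "U \<subseteq> Z" using that T by blast
    show "indep_mod N U" using T(2) that(1) unfolding indep_mod_def by (meson subset_trans)
  qed
  have "finite T"
  proof (rule ccontr)
    assume "infinite T"
    then obtain U where "U \<subseteq> T" "finite U" "card U = Suc (card S)"
      using infinite_arbitrarily_large by blast
    then show False using le[of U] by simp
  qed
  then show ?thesis using True le by (simp add: ecard_def)
qed (simp add: ecard_def)

lemma basis_mod_ecard_eq:
  assumes "subspace N" "basis_mod Z N S" "basis_mod Z N T"
  shows "ecard S = ecard T"
  using basis_mod_ecard_le[OF assms(1,2), of T] basis_mod_ecard_le[OF assms(1,3), of S] assms(2,3)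
  by (auto simp: basis_mod_def)

text \<open>For subspaces \<open>N\<close> inside \<open>Z\<close> this is the dimension of the
  quotient \<open>Z / N\<close>, computed without forming cosets; \<open>dim_mod_eq\<close> shows
  that the choice of the basis does not matter.\<close>

definition dim_mod :: "'b set \<Rightarrow> 'b set \<Rightarrow> enat" where
  "dim_mod Z N = ecard (SOME S. basis_mod Z N S)"

lemma dim_mod_eq:
  assumes "subspace N" "basis_mod Z N S"
  shows "dim_mod Z N = ecard S"
  unfolding dim_mod_def using assms basis_mod_ecard_eq by (metis someI)

lemma dim_mod_self:
  assumes "subspace N"
  shows "dim_mod N N = 0"
proof -
  have "basis_mod N N {}" by (auto simp: basis_mod_def indep_mod_def)
  then show ?thesis using dim_mod_eq assms by (simp add: ecard_def zero_enat_def)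
qed

text \<open>The second isomorphism theorem on representatives: \<open>Z / (Z \<inter> N)\<close> and
  \<open>(Z + N) / N\<close> have the same bases, and every \<open>Y\<close> between
  \<open>Z\<close> and \<open>Z + N\<close> has the same image modulo \<open>N\<close>.\<close>

lemma basis_mod_add_subspace:
  assumes S: "basis_mod Z (Z \<inter> N) S" and N: "subspace N" and Z: "subspace Z"
    and sub: "Z \<subseteq> Y" and Y: "\<And>y. y \<in> Y \<Longrightarrow> \<exists>z\<in>Z. y - z \<in> N"
  shows "basis_mod Y N S"
  unfolding basis_mod_def
proof (intro conjI ballI)
  have SZ: "S \<subseteq> Z" using S by (simp add: basis_mod_def)
  then show "S \<subseteq> Y" using sub by blast
  show "indep_mod N S"
    unfolding indep_mod_def
  proof (intro allI impI ballI)
    fix T a t assume *: "finite T" "T \<subseteq> S" "(\<Sum>t\<in>T. scale (a t) t) \<in> N" "t \<in> T"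
    have "(\<Sum>t\<in>T. scale (a t) t) \<in> Z"
      using * SZ by (intro subspace_sum[OF Z] subspace_scale[OF Z]) auto
    then show "a t = 0"
      using * S indep_modD[of "Z \<inter> N" S T a t] by (auto simp: basis_mod_def)
  qed
next
  fix y assume "y \<in> Y"
  then obtain z where z: "z \<in> Z" "y - z \<in> N" using Y by blast
  then obtain x where "x \<in> span S" "z - x \<in> N" using S by (auto simp: basis_mod_def)
  then show "\<exists>x\<in>span S. y - x \<in> N"
    using subspace_add[OF N z(2), of "z - x"] by (intro bexI[of _ x]) auto
qed

text \<open>Additivity of dimension for the short exact sequence \<open>Z1 / N1\<close>,
  \<open>Z2 / N2\<close>, \<open>Z3 / N3\<close> whose maps are induced by inclusions. A basis of
  the first term together with lifts of a basis of the third is a basis of the middle term.\<close>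

theorem dim_mod_add:
  assumes sub: "subspace Z1" "subspace Z2" "subspace N1" "subspace N2" "subspace N3"
    and incl: "N1 \<subseteq> Z1" "Z1 \<subseteq> Z2" "N1 \<subseteq> N2" "N2 \<subseteq> N3" "N2 \<subseteq> Z2" "Z1 \<subseteq> N3" "Z2 \<subseteq> Z3"
    and inj: "\<And>x. x \<in> Z1 \<Longrightarrow> x \<in> N2 \<Longrightarrow> x \<in> N1"
    and exact: "\<And>x. x \<in> Z2 \<Longrightarrow> x \<in> N3 \<Longrightarrow> \<exists>z\<in>Z1. x - z \<in> N2"
    and surj: "\<And>x. x \<in> Z3 \<Longrightarrow> \<exists>z\<in>Z2. x - z \<in> N3"
  shows "dim_mod Z2 N2 = dim_mod Z1 N1 + dim_mod Z3 N3"
proof -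
  obtain S where S: "basis_mod Z1 N1 S" using basis_mod_exists sub incl by blast
  \<comment> \<open>Choosing the basis inside \<open>Z2\<close> lifts it in advance; by
    \<open>surj\<close> it is a basis of the third term as well.\<close>
  obtain R where R: "basis_mod Z2 (Z2 \<inter> N3) R"
    using basis_mod_exists[of Z2 "Z2 \<inter> N3"] sub subspace_inter by blast
  have R3: "basis_mod Z3 N3 R"
    using basis_mod_add_subspace[OF R] sub incl surj by blast
  have SZ: "S \<subseteq> Z1" and RZ: "R \<subseteq> Z2" and iS: "indep_mod N1 S" and iR: "indep_mod N3 R"
    using S R R3 by (auto simp: basis_mod_def)
  have disj: "S \<inter> R = {}"
  proof (rule ccontr)
    assume "S \<inter> R \<noteq> {}"
    then obtain r where r: "r \<in> S" "r \<in> R" by blast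
    then have "(\<Sum>t\<in>{r}. scale 1 t) \<in> N3" using SZ incl by auto
    from indep_modD[OF iR _ _ this, of r] r show False by simp
  qed
  have "basis_mod Z2 N2 (S \<union> R)"
    unfolding basis_mod_def
  proof (intro conjI ballI)
    show "S \<union> R \<subseteq> Z2" using SZ RZ incl by blast
    show "indep_mod N2 (S \<union> R)"
      unfolding indep_mod_def
    proof (intro allI impI ballI)
      fix T a t assume T: "finite T" "T \<subseteq> S \<union> R" "(\<Sum>t\<in>T. scale (a t) t) \<in> N2" "t \<in> T"
      have split: "(\<Sum>t\<in>T. scale (a t) t) = (\<Sum>t\<in>T\<inter>S. scale (a t) t) + (\<Sum>t\<in>T\<inter>R. scale (a t) t)"
      proof -
        have "T = (T \<inter> S) \<union> (T \<inter> R)" using T by blast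
        moreover have "(T \<inter> S) \<inter> (T \<inter> R) = {}" using disj by blast
        ultimately show ?thesis
          using sum.union_disjoint[of "T \<inter> S" "T \<inter> R" "\<lambda>t. scale (a t) t"] T(1) by simp
      qed
      have s1: "(\<Sum>t\<in>T\<inter>S. scale (a t) t) \<in> Z1"
        using SZ by (intro subspace_sum sub subspace_scale) auto
      have "(\<Sum>t\<in>T\<inter>R. scale (a t) t) \<in> N3"
        using split T(3) s1 incl
          subspace_diff[OF sub(5), of "\<Sum>t\<in>T. scale (a t) t" "\<Sum>t\<in>T\<inter>S. scale (a t) t"]
        by (auto simp: subset_iff)
      then have 0: "a u = 0" if "u \<in> T \<inter> R" for u
        using indep_modD[OF iR, of "T \<inter> R" a u] T that by auto
      then have "(\<Sum>t\<in>T\<inter>R. scale (a t) t) = 0" by simp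
      then have "(\<Sum>t\<in>T\<inter>S. scale (a t) t) \<in> N1"
        using split T(3) inj s1 by simp
      then have "a u = 0" if "u \<in> T \<inter> S" for u
        using indep_modD[OF iS, of "T \<inter> S" a u] T that by auto
      then show "a t = 0" using 0 T by blast
    qed
  next
    fix z assume z: "z \<in> Z2"
    then obtain r where r: "r \<in> span R" "z - r \<in> Z2 \<inter> N3" using R by (auto simp: basis_mod_def)
    then obtain y where y: "y \<in> Z1" "z - r - y \<in> N2" using exact[of "z - r"] by auto
    then obtain s where s: "s \<in> span S" "y - s \<in> N1" using S by (auto simp: basis_mod_def)
    have "(z - r - y) + (y - s) \<in> N2" using y s incl by (intro subspace_add sub) auto
    moreover have "s + r \<in> span (S \<union> R)" using s r by (auto simp: span_Un)
    ultimately show "\<exists>x\<in>span (S \<union> R). z - x \<in> N2"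
      by (intro bexI[of _ "s + r"]) (auto simp: algebra_simps)
  qed
  then show ?thesis
    using dim_mod_eq[OF sub(4)] dim_mod_eq[OF sub(3) S] dim_mod_eq[OF sub(5) R3]
    by (simp add: ecard_Un_disjoint disj)
qed

text \<open>The hypotheses say that \<open>\<phi>\<close> induces an isomorphism of the quotients,
  so it carries representatives of a basis to representatives of a basis.\<close>

lemma dim_mod_linear:
  assumes sub: "subspace Z" "subspace N" "subspace N'" "N \<subseteq> Z"
    and \<phi>: "Vector_Spaces.linear scale scale \<phi>"
    and img: "\<And>x. x \<in> Z \<Longrightarrow> \<phi> x \<in> Z'" "\<And>x. x \<in> N \<Longrightarrow> \<phi> x \<in> N'"
    and inj: "\<And>x. x \<in> Z \<Longrightarrow> \<phi> x \<in> N' \<Longrightarrow> x \<in> N"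
    and surj: "\<And>y. y \<in> Z' \<Longrightarrow> \<exists>x\<in>Z. y - \<phi> x \<in> N'"
  shows "dim_mod Z' N' = dim_mod Z N"
proof -
  interpret L: Vector_Spaces.linear scale scale \<phi> by fact
  interpret vector_space_pair scale scale ..
  obtain S where S: "basis_mod Z N S" using basis_mod_exists sub by blast
  then have SZ: "S \<subseteq> Z" and iS: "indep_mod N S" by (auto simp: basis_mod_def)
  have rel: "a t = 0" if "finite T" "T \<subseteq> S" "(\<Sum>t\<in>T. scale (a t) (\<phi> t)) \<in> N'" "t \<in> T" for T a t
  proof -
    have "\<phi> (\<Sum>t\<in>T. scale (a t) t) \<in> N'" using that by (simp add: L.sum L.scale)
    moreover have "(\<Sum>t\<in>T. scale (a t) t) \<in> Z"
      using that SZ by (intro subspace_sum sub subspace_scale) auto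
    ultimately show ?thesis using inj indep_modD[OF iS] that by blast
  qed
  have injS: "inj_on \<phi> S"
  proof (rule inj_onI, rule ccontr)
    fix s t assume st: "s \<in> S" "t \<in> S" "\<phi> s = \<phi> t" "s \<noteq> t"
    let ?a = "\<lambda>u. if u = s then 1 :: 'r else - 1"
    have "(\<Sum>u\<in>{s,t}. scale (?a u) (\<phi> u)) \<in> N'" using st subspace_0[OF sub(3)] by simp
    from rel[OF _ _ this, of s] st show False by auto
  qed
  have "basis_mod Z' N' (\<phi> ` S)"
    unfolding basis_mod_def
  proof (intro conjI ballI)
    show "\<phi> ` S \<subseteq> Z'" using SZ img by blast
    show "indep_mod N' (\<phi> ` S)"
      unfolding indep_mod_def
    proof (intro allI impI ballI)
      fix T a t assume T: "finite T" "T \<subseteq> \<phi> ` S" "(\<Sum>t\<in>T. scale (a t) t) \<in> N'" "t \<in> T"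
      then obtain R where R: "R \<subseteq> S" "T = \<phi> ` R" by (meson subset_imageE)
      have injR: "inj_on \<phi> R" using injS R inj_on_subset by blast
      have "finite R" using T R injR finite_image_iff by blast
      moreover obtain r where r: "r \<in> R" "t = \<phi> r" using R T by blast
      moreover have "(\<Sum>t\<in>R. scale (a (\<phi> t)) (\<phi> t)) \<in> N'"
        using T R by (simp add: sum.reindex[OF injR])
      ultimately show "a t = 0" using rel[of R "a \<circ> \<phi>" r] R by simp
    qed
  next
    fix y assume "y \<in> Z'"
    then obtain x where x: "x \<in> Z" "y - \<phi> x \<in> N'" using surj by blast
    then obtain s where s: "s \<in> span S" "x - s \<in> N" using S by (auto simp: basis_mod_def)
    have "(y - \<phi> x) + \<phi> (x - s) \<in> N'" using x s img by (intro subspace_add sub) auto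
    moreover have "\<phi> s \<in> span (\<phi> ` S)" using s L.span_image by auto
    ultimately show "\<exists>x\<in>span (\<phi> ` S). y - x \<in> N'"
      by (intro bexI[of _ "\<phi> s"]) (auto simp: L.diff)
  qed
  then show ?thesis
    using dim_mod_eq[OF sub(3)] dim_mod_eq[OF sub(2) S] ecard_image[OF injS] by simp
qed

end

section \<open>Dimension of quotient modules of rational chains\<close>

interpretation rchain: vspace "rchain_scale :: rat \<Rightarrow> 'a rchain \<Rightarrow> 'a rchain"
  by unfold_locales (auto intro!: poly_mapping_eqI simp: lookup_add algebra_simps)

context
  fixes Z N :: "'a rchain set"
  assumes Z: "rchain.subspace Z" and N: "rchain.subspace N" and NZ: "N \<subseteq> Z"
begin

abbreviation (input) "sub_module \<equiv> rchain_module\<lparr>carrier := Z\<rparr>"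
abbreviation (input) "quot \<equiv> quotient_module sub_module N"
abbreviation (input) "coset x \<equiv> N +>\<^bsub>sub_module\<^esub> x"

lemma submodule_subspaces:
  "Module.module rat_ring sub_module" "submodule N rat_ring sub_module"
proof -
  have sm: "submodule W rat_ring (rchain_module :: (rat, 'a rchain) module)"
    if "rchain.subspace W" for W
    using that by (intro submodule_rchain_moduleI)
      (auto intro: rchain.subspace_0 rchain.subspace_add rchain.subspace_scale)
  show *: "Module.module rat_ring sub_module"
    using submodule.submodule_is_module[OF sm[OF Z] module_rchain_module] .
  show "submodule N rat_ring sub_module"
    using module.module_incl_imp_submodule[OF *, of N] NZ
      submodule.submodule_is_module[OF sm[OF N] module_rchain_module] by simp
qed

lemma coset_eq: "coset x = (\<lambda>n. n + x) ` N"
  by (auto simp: a_r_coset_def' rchain_module_def)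

lemma coset_eq_iff: "coset x = coset y \<longleftrightarrow> x - y \<in> N"
proof
  assume "coset x = coset y"
  then have "x \<in> (\<lambda>n. n + y) ` N"
    unfolding coset_eq using rchain.subspace_0[OF N] by (metis add_0 image_eqI)
  then show "x - y \<in> N" by auto
next
  assume xy: "x - y \<in> N"
  have "n + x \<in> (\<lambda>n. n + y) ` N" if "n \<in> N" for n
    using rchain.subspace_add[OF N that xy] by (intro image_eqI[of _ _ "n + (x - y)"]) auto
  moreover have "n + y \<in> (\<lambda>n. n + x) ` N" if "n \<in> N" for n
    using rchain.subspace_diff[OF N that xy] by (intro image_eqI[of _ _ "n - (x - y)"]) auto
  ultimately show "coset x = coset y" unfolding coset_eq by blast
qed

lemma carrier_quotient: "carrier quot = (\<lambda>x. coset x) ` Z"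
  by (auto simp: quotient_module_def A_RCOSETS_def')

lemma zero_quotient: "\<zero>\<^bsub>quot\<^esub> = coset 0"
  by (simp add: quotient_module_def coset_eq)

lemma coset_add:
  assumes "x \<in> Z" "y \<in> Z"
  shows "coset x \<oplus>\<^bsub>quot\<^esub> coset y = coset (x + y)"
proof -
  interpret S: Module.module rat_ring sub_module by (rule submodule_subspaces)
  interpret sN: submodule N rat_ring sub_module by (rule submodule_subspaces)
  interpret AN: abelian_subgroup N sub_module
    by (intro abelian_subgroupI3 additive_subgroup.intro sN.subgroup_axioms) unfold_locales
  show ?thesis
    using AN.a_rcos_sum[of x y] assms by (simp add: quotient_module_def) (simp add: rchain_module_def)
qed

lemma coset_scale:
  assumes "x \<in> Z"
  shows "q \<odot>\<^bsub>quot\<^esub> coset x = coset (rchain_scale q x)"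
  using quotient_module_smult_rcoset[OF submodule_subspaces, of q x] assms
  by (simp add: rat_ring_def) (simp add: rchain_module_def)

lemma coset_finsum:
  assumes "finite S" "g \<in> S \<rightarrow> Z"
  shows "(\<Oplus>\<^bsub>quot\<^esub>s\<in>S. coset (g s)) = coset (\<Sum>s\<in>S. g s)"
proof -
  interpret Q: Module.module rat_ring quot
    by (rule module_quotient_module[OF submodule_subspaces])
  show ?thesis
    using assms
  proof (induction S)
    case (insert s S)
    have "(\<Sum>s\<in>S. g s) \<in> Z" using insert by (intro rchain.subspace_sum Z) auto
    moreover have "(\<lambda>s. coset (g s)) \<in> S \<rightarrow> carrier quot" "coset (g s) \<in> carrier quot"
      using insert by (auto simp: carrier_quotient)
    ultimately show ?case using insert by (simp add: coset_add)
  qed (simp add: zero_quotient)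
qed

lemma coset_lincomb:
  assumes "finite S" "S \<subseteq> Z" "inj_on (\<lambda>x. coset x) S"
  shows "(\<Oplus>\<^bsub>quot\<^esub>v\<in>(\<lambda>x. coset x) ` S. a v \<odot>\<^bsub>quot\<^esub> v)
    = coset (\<Sum>s\<in>S. rchain_scale (a (coset s)) s)"
proof -
  interpret Q: Module.module rat_ring quot
    by (rule module_quotient_module[OF submodule_subspaces])
  have sc: "rchain_scale q s \<in> Z" if "s \<in> S" for q s
    using that assms by (intro rchain.subspace_scale Z) auto
  have "(\<lambda>v. a v \<odot>\<^bsub>quot\<^esub> v) \<in> (\<lambda>x. coset x) ` S \<rightarrow> carrier quot"
    using assms sc by (auto simp: carrier_quotient coset_scale subset_iff)
  then have "(\<Oplus>\<^bsub>quot\<^esub>v\<in>(\<lambda>x. coset x) ` S. a v \<odot>\<^bsub>quot\<^esub> v)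
    = (\<Oplus>\<^bsub>quot\<^esub>s\<in>S. a (coset s) \<odot>\<^bsub>quot\<^esub> coset s)"
    using assms by (simp add: Q.finsum_reindex)
  also have "\<dots> = (\<Oplus>\<^bsub>quot\<^esub>s\<in>S. coset (rchain_scale (a (coset s)) s))"
    using assms sc by (intro Q.finsum_cong') (auto simp: carrier_quotient coset_scale subset_iff)
  also have "\<dots> = coset (\<Sum>s\<in>S. rchain_scale (a (coset s)) s)"
    using assms sc by (intro coset_finsum) auto
  finally show ?thesis .
qed

text \<open>In \<open>finite_basis\<close> the coefficients are indexed by cosets, in
  \<open>basis_mod\<close> by representatives. Since the coset map is injective on \<open>S\<close>,
  either kind of coefficient family can be turned into the other.\<close>

lemma finite_basis_coset_iff:
  assumes S: "finite S" "S \<subseteq> Z" "inj_on (\<lambda>x. coset x) S"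
  shows "finite_basis rat_ring quot ((\<lambda>x. coset x) ` S) \<longleftrightarrow> rchain.basis_mod Z N S"
proof -
  have inv: "\<exists>b. \<forall>s\<in>S. b (coset s) = a s" for a :: "_ \<Rightarrow> rat"
    by (rule exI[of _ "a \<circ> the_inv_into S (\<lambda>x. coset x)"]) (use S in \<open>simp add: the_inv_into_f_f\<close>)
  have R: "carrier rat_ring = UNIV" "\<zero>\<^bsub>rat_ring\<^esub> = 0" by (simp_all add: rat_ring_def)
  have zero: "coset x = \<zero>\<^bsub>quot\<^esub> \<longleftrightarrow> x \<in> N" for x by (simp add: zero_quotient coset_eq_iff)
  have "(\<forall>b. (\<Sum>s\<in>S. rchain_scale (b (coset s)) s) \<in> N \<longrightarrow> (\<forall>s\<in>S. b (coset s) = 0))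
    \<longleftrightarrow> (\<forall>a. (\<Sum>s\<in>S. rchain_scale (a s) s) \<in> N \<longrightarrow> (\<forall>s\<in>S. a s = 0))" (is "_ \<longleftrightarrow> ?ind")
  proof (intro iffI allI impI)
    fix a assume *: "\<forall>b. (\<Sum>s\<in>S. rchain_scale (b (coset s)) s) \<in> N \<longrightarrow> (\<forall>s\<in>S. b (coset s) = 0)"
      and a: "(\<Sum>s\<in>S. rchain_scale (a s) s) \<in> N"
    obtain b where "\<forall>s\<in>S. b (coset s) = a s" using inv by blast
    then show "\<forall>s\<in>S. a s = 0" using * a by (metis (no_types, lifting) sum.cong)
  qed auto
  also have "?ind \<longleftrightarrow> rchain.indep_mod N S"
  proof
    assume ind: ?ind
    show "rchain.indep_mod N S"
      unfolding rchain.indep_mod_def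
    proof (intro allI impI)
      fix T a assume T: "finite T" "T \<subseteq> S" "(\<Sum>t\<in>T. rchain_scale (a t) t) \<in> N"
      have "(\<Sum>s\<in>S. rchain_scale (if s \<in> T then a s else 0) s) = (\<Sum>t\<in>T. rchain_scale (a t) t)"
        using T S by (intro sum.mono_neutral_cong_right) auto
      then have "\<forall>s\<in>S. (if s \<in> T then a s else 0) = 0"
        using ind[rule_format, of "\<lambda>s. if s \<in> T then a s else 0"] T by auto
      then show "\<forall>t\<in>T. a t = 0" using T by (metis subsetD)
    qed
  qed (use rchain.indep_modD S in blast)
  finally have ind: "(\<forall>b. (\<Sum>s\<in>S. rchain_scale (b (coset s)) s) \<in> N \<longrightarrow> (\<forall>s\<in>S. b (coset s) = 0))
    \<longleftrightarrow> rchain.indep_mod N S" .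
  have sp: "(\<forall>x\<in>Z. \<exists>b. x - (\<Sum>s\<in>S. rchain_scale (b (coset s)) s) \<in> N)
    \<longleftrightarrow> (\<forall>x\<in>Z. \<exists>y\<in>rchain.span S. x - y \<in> N)"
  proof -
    have "(\<exists>b. x - (\<Sum>s\<in>S. rchain_scale (b (coset s)) s) \<in> N) \<longleftrightarrow> (\<exists>y\<in>rchain.span S. x - y \<in> N)" for x
    proof -
      have "(\<exists>b. x - (\<Sum>s\<in>S. rchain_scale (b (coset s)) s) \<in> N)
          \<longleftrightarrow> (\<exists>a. x - (\<Sum>s\<in>S. rchain_scale (a s) s) \<in> N)"
      proof
        assume "\<exists>a. x - (\<Sum>s\<in>S. rchain_scale (a s) s) \<in> N"
        then obtain a where a: "x - (\<Sum>s\<in>S. rchain_scale (a s) s) \<in> N" by blast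
        obtain b where "\<forall>s\<in>S. b (coset s) = a s" using inv by blast
        then have "(\<Sum>s\<in>S. rchain_scale (b (coset s)) s) = (\<Sum>s\<in>S. rchain_scale (a s) s)" by simp
        then show "\<exists>b. x - (\<Sum>s\<in>S. rchain_scale (b (coset s)) s) \<in> N"
            using a by (intro exI[of _ b]) simp
      qed auto
      then show ?thesis using S by (auto simp: rchain.span_finite)
    qed
    then show ?thesis by simp
  qed
  have "finite_basis rat_ring quot ((\<lambda>x. coset x) ` S) \<longleftrightarrow>
    (\<forall>b. (\<Sum>s\<in>S. rchain_scale (b (coset s)) s) \<in> N \<longrightarrow> (\<forall>s\<in>S. b (coset s) = 0)) \<and>
    (\<forall>x\<in>Z. \<exists>b. x - (\<Sum>s\<in>S. rchain_scale (b (coset s)) s) \<in> N)"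
    unfolding finite_basis_def
    using S by (auto simp: coset_lincomb R zero carrier_quotient coset_eq_iff image_subset_iff subset_iff)
  also have "\<dots> \<longleftrightarrow> rchain.basis_mod Z N S"
    unfolding ind sp rchain.basis_mod_def using S by blast
  finally show ?thesis .
qed

text \<open>A finite basis of cosets lifts to representatives, and finitely many representatives of
  a basis give a finite basis of cosets. Hence both sides are finite and equal, or both are
  \<open>\<infinity>\<close>.\<close>

lemma vdim_quotient_module: "vdim rat_ring quot = rchain.dim_mod Z N"
proof -
  have basis: "rchain.dim_mod Z N = enat (card B)" if B: "finite_basis rat_ring quot B" for B
  proof -
    have "\<forall>v\<in>B. \<exists>x\<in>Z. coset x = v" using B by (auto simp: finite_basis_def carrier_quotient)
    then obtain r where r: "\<And>v. v \<in> B \<Longrightarrow> r v \<in> Z \<and> coset (r v) = v" by metis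
    have inj: "inj_on r B" "inj_on (\<lambda>x. coset x) (r ` B)"
      using r by (auto intro!: inj_on_inverseI[of _ "\<lambda>x. coset x"] inj_on_inverseI[of _ r])
    have "(\<lambda>x. coset x) ` r ` B = B" using r by force
    moreover have "finite B" using B by (simp add: finite_basis_def)
    ultimately have "rchain.basis_mod Z N (r ` B)"
      using finite_basis_coset_iff[of "r ` B"] B r inj by auto
    then show ?thesis
      using rchain.dim_mod_eq[OF N] \<open>finite B\<close> inj by (simp add: ecard_def card_image)
  qed
  show ?thesis
  proof (cases "\<exists>B. finite_basis rat_ring quot B")
    case True
    then show ?thesis using basis someI_ex[OF True] by (simp add: vdim_def)
  next
    case False
    obtain S where S: "rchain.basis_mod Z N S" using rchain.basis_mod_exists[OF Z N NZ] .
    have "infinite S"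
    proof
      assume fin: "finite S"
      have iS: "rchain.indep_mod N S" and SZ: "S \<subseteq> Z" using S by (auto simp: rchain.basis_mod_def)
      have "inj_on (\<lambda>x. coset x) S"
      proof (rule inj_onI, rule ccontr)
        fix s t assume st: "s \<in> S" "t \<in> S" "coset s = coset t" "s \<noteq> t"
        let ?a = "\<lambda>u. if u = s then 1 else - 1 :: rat"
        have "(\<Sum>u\<in>{s,t}. rchain_scale (?a u) u) \<in> N"
          using st by (simp add: coset_eq_iff)
        from rchain.indep_modD[OF iS _ _ this, of s] st show False by auto
      qed
      then have "finite_basis rat_ring quot ((\<lambda>x. coset x) ` S)"
        using finite_basis_coset_iff fin SZ S by blast
      then show False using False by blast
    qed
    then have "rchain.dim_mod Z N = \<infinity>" using rchain.dim_mod_eq[OF N S] by (simp add: ecard_def)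
    then show ?thesis using False by (simp add: vdim_def)
  qed
qed

end

section \<open>Rational chains and integral chains\<close>

text \<open>The finitely many coefficients have a common denominator; the product of their reduced
  denominators is used.\<close>

lemma clear_denominators:
  obtains k :: int and c' where "k \<noteq> 0" "rchain_scale (of_int k) c = rchain_of_chain c'"
proof -
  define k where "k = (\<Prod>s\<in>Poly_Mapping.keys c. snd (quotient_of (Poly_Mapping.lookup c s)))"
  have pos: "snd (quotient_of q) > 0" for q by (rule quotient_of_denom_pos')
  have k0: "k \<noteq> 0" unfolding k_def using pos by (simp add: less_le[THEN iffD1, OF pos, THEN conjunct2, symmetric])
  \<comment> \<open>The floor only changes the type: \<open>k\<close> times each coefficient is
    shown below to be an integer.\<close>
  define c' where "c' = Poly_Mapping.map (\<lambda>q. \<lfloor>of_int k * q\<rfloor>) c"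
  have "of_int k * Poly_Mapping.lookup c s \<in> \<int>" for s
  proof (cases "s \<in> Poly_Mapping.keys c")
    case True
    let ?q = "Poly_Mapping.lookup c s"
    have "snd (quotient_of ?q) dvd k" unfolding k_def using True by (intro dvd_prodI) auto
    then obtain m where m: "k = snd (quotient_of ?q) * m" by (auto simp: dvd_def)
    have "?q = of_int (fst (quotient_of ?q)) / of_int (snd (quotient_of ?q))"
      by (simp add: quotient_of_div)
    then have "of_int (snd (quotient_of ?q)) * ?q = of_int (fst (quotient_of ?q))"
      using pos[of ?q] by (metis less_numeral_extra(3) nonzero_mult_div_cancel_left of_int_eq_0_iff times_divide_eq_right)
    then have "of_int k * ?q = of_int (m * fst (quotient_of ?q))"
      by (simp add: m)
    then show ?thesis by (metis Ints_of_int)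
  qed (simp add: in_keys_iff)
  then have "rchain_scale (of_int k) c = rchain_of_chain c'"
    by (intro poly_mapping_eqI)
      (simp add: c'_def Poly_Mapping.map.rep_eq when_def in_keys_iff)
  then show thesis using that k0 by blast
qed

lemma rchain_of_chain_diff: "rchain_of_chain (c - d) = rchain_of_chain c - rchain_of_chain d"
  by (rule poly_mapping_eqI) (simp add: lookup_minus)

lemma rchain_of_chain_cmul: "rchain_of_chain (frag_cmul k c) = rchain_scale (of_int k) (rchain_of_chain c)"
  by (rule poly_mapping_eqI) simp

lemma singular_rchain_of_chain [simp]: "singular_rchain p X (rchain_of_chain c) \<longleftrightarrow> singular_chain p X c"
  by (simp add: singular_rchain_def singular_chain_def)

lemma subspace_relcycles: "rchain.subspace (rat_relcycles p X S)"
  unfolding rchain.subspace_def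
  by (auto simp: rat_relcycles_def rchain_boundary_add rchain_boundary_scale
      singular_rchain_add singular_rchain_scale) (simp add: rchain_boundary_def)

lemma subspace_relboundaries: "rchain.subspace (rat_relboundaries p X S)"
proof -
  interpret submodule "rat_relboundaries p X S" rat_ring "rchain_module :: (rat, 'a rchain) module"
    by (rule submodule_rat_relboundaries)
  have add: "x + y \<in> rat_relboundaries p X S"
    if "x \<in> rat_relboundaries p X S" "y \<in> rat_relboundaries p X S" for x y
    using m_closed[of x y] that by (simp add: rchain_module_def)
  have scale: "rchain_scale q x \<in> rat_relboundaries p X S" if "x \<in> rat_relboundaries p X S" for q x
    using smult_closed[of q x] that by (simp add: rchain_module_def rat_ring_def)
  have "0 \<in> rat_relboundaries p X S"
    by (auto simp: rat_relboundaries_def rchain_boundary_def intro!: exI[of _ 0])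
  then show ?thesis using add scale by (auto simp: rchain.subspace_def)
qed

lemma subspace_scale_int_iff:
  assumes "rchain.subspace W" "k \<noteq> 0"
  shows "rchain_scale (of_int k) c \<in> W \<longleftrightarrow> c \<in> W"
proof
  assume "rchain_scale (of_int k) c \<in> W"
  from rchain.subspace_scale[OF assms(1) this, of "inverse (of_int k)"]
  show "c \<in> W" using assms by simp
qed (use assms rchain.subspace_scale in blast)

lemma relcycles_of_chain:
  "rchain_of_chain c \<in> rat_relcycles p X S \<longleftrightarrow> singular_relcycle p X S c"
  by (simp add: rat_relcycles_def singular_relcycle_def mod_subset_def rchain_boundary_of_chain)

text \<open>An integral chain bounds rationally exactly when some nonzero multiple bounds
  integrally: the kernel of the passage from integral to rational homology is torsion. The factor
  \<open>k\<close> clears the denominators of the bounding chain.\<close>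

lemma relboundaries_of_chain:
  "rchain_of_chain c \<in> rat_relboundaries p X S
    \<longleftrightarrow> (\<exists>k. k \<noteq> 0 \<and> singular_relboundary p X S (frag_cmul k c))"
proof
  assume "rchain_of_chain c \<in> rat_relboundaries p X S"
  then obtain d where d: "singular_rchain (Suc p) X d"
    "singular_rchain p (subtopology X S) (rchain_boundary (Suc p) d - rchain_of_chain c)"
    by (auto simp: rat_relboundaries_def)
  obtain k d' where k: "k \<noteq> 0" and d': "rchain_scale (of_int k) d = rchain_of_chain d'"
    by (rule clear_denominators)
  have "singular_chain (Suc p) X d'"
    using singular_rchain_scale[OF d(1), of "of_int k"] by (simp add: d')
  moreover have "rchain_scale (of_int k) (rchain_boundary (Suc p) d - rchain_of_chain c)
      = rchain_of_chain (chain_boundary (Suc p) d' - frag_cmul k c)"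
    by (simp add: rchain.scale_right_diff_distrib rchain_boundary_scale[symmetric] d'
        rchain_boundary_of_chain rchain_of_chain_diff rchain_of_chain_cmul)
  then have "singular_chain p (subtopology X S) (chain_boundary (Suc p) d' - frag_cmul k c)"
    using singular_rchain_scale[OF d(2), of "of_int k"] by simp
  ultimately show "\<exists>k. k \<noteq> 0 \<and> singular_relboundary p X S (frag_cmul k c)"
    using k by (auto simp: singular_relboundary_def mod_subset_def)
next
  assume "\<exists>k. k \<noteq> 0 \<and> singular_relboundary p X S (frag_cmul k c)"
  then obtain k d where k: "k \<noteq> 0" and d: "singular_chain (Suc p) X d"
    "singular_chain p (subtopology X S) (chain_boundary (Suc p) d - frag_cmul k c)"
    by (auto simp: singular_relboundary_def mod_subset_def)
  then have "rchain_of_chain (frag_cmul k c) \<in> rat_relboundaries p X S"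
    unfolding rat_relboundaries_def
    by (intro CollectI exI[of _ "rchain_of_chain d"])
      (simp add: rchain_boundary_of_chain rchain_of_chain_diff[symmetric])
  then show "rchain_of_chain c \<in> rat_relboundaries p X S"
    using k by (simp add: rchain_of_chain_cmul subspace_scale_int_iff subspace_relboundaries)
qed

definition rchain_map :: "nat \<Rightarrow> ('a \<Rightarrow> 'b) \<Rightarrow> 'a rchain \<Rightarrow> 'b rchain" where
  "rchain_map p f c =
     (\<Sum>s\<in>Poly_Mapping.keys c. Poly_Mapping.single (simplex_map p f s) (Poly_Mapping.lookup c s))"

lemma rchain_map_superset:
  assumes "finite T" "Poly_Mapping.keys c \<subseteq> T"
  shows "rchain_map p f c =
    (\<Sum>s\<in>T. Poly_Mapping.single (simplex_map p f s) (Poly_Mapping.lookup c s))"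
  using assms unfolding rchain_map_def
  by (intro sum.mono_neutral_left) (auto simp: in_keys_iff)

lemma rchain_map_add: "rchain_map p f (c + d) = rchain_map p f c + rchain_map p f d"
proof -
  let ?T = "Poly_Mapping.keys c \<union> Poly_Mapping.keys d"
  have "Poly_Mapping.keys (c + d) \<subseteq> ?T" by (rule Poly_Mapping.keys_add)
  then show ?thesis
    by (simp add: rchain_map_superset[of ?T] lookup_add single_add sum.distrib)
qed

lemma rchain_map_scale: "rchain_map p f (rchain_scale q c) = rchain_scale q (rchain_map p f c)"
  by (simp add: rchain_map_superset[of "Poly_Mapping.keys c"] keys_rchain_scale rchain_scale_sum
      rchain_scale_single)

lemma linear_rchain_map: "Vector_Spaces.linear rchain_scale rchain_scale (rchain_map p f)"
  by unfold_locales (simp_all add: rchain_map_add rchain_map_scale)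

lemma rchain_map_of_chain:
  fixes f :: "'a \<Rightarrow> 'b"
  shows "rchain_map p f (rchain_of_chain c) = rchain_of_chain (chain_map p f c)"
proof -
  have "rchain_of_chain (frag_cmul a (frag_of t)) = Poly_Mapping.single t (of_int a)"
    for a :: int and t :: "(nat \<Rightarrow> real) \<Rightarrow> 'b"
    by (rule poly_mapping_eqI) (auto simp: lookup_single when_def)
  then show ?thesis
    by (simp add: rchain_map_def chain_map_def frag_extend_def rchain_of_chain_sum)
qed

text \<open>A nonzero multiple of the cycle is integral, where the library result on chain maps
  applies; the multiple is then divided out in the subspace of rational cycles.\<close>

lemma rchain_map_relcycles:
  assumes "continuous_map X Y f" "f \<in> S \<rightarrow> T" and c: "c \<in> rat_relcycles p X S"
  shows "rchain_map p f c \<in> rat_relcycles p Y T"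
proof -
  obtain k c' where k: "k \<noteq> 0" "rchain_scale (of_int k) c = rchain_of_chain c'"
    by (rule clear_denominators)
  then have "singular_relcycle p X S c'"
    using c relcycles_of_chain rchain.subspace_scale[OF subspace_relcycles] by metis
  then have "rchain_of_chain (chain_map p f c') \<in> rat_relcycles p Y T"
    using assms by (simp add: relcycles_of_chain singular_relcycle_chain_map)
  then have "rchain_scale (of_int k) (rchain_map p f c) \<in> rat_relcycles p Y T"
    using k by (simp add: rchain_map_scale[symmetric] rchain_map_of_chain)
  then show ?thesis using k by (simp add: subspace_scale_int_iff subspace_relcycles)
qed

lemma rchain_map_relboundaries:
  assumes "continuous_map X Y f" "f \<in> S \<rightarrow> T" and c: "c \<in> rat_relboundaries p X S"
  shows "rchain_map p f c \<in> rat_relboundaries p Y T"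
proof -
  obtain k c' where k: "k \<noteq> 0" "rchain_scale (of_int k) c = rchain_of_chain c'"
    by (rule clear_denominators)
  then have "rchain_of_chain c' \<in> rat_relboundaries p X S"
    using c rchain.subspace_scale[OF subspace_relboundaries] by metis
  then obtain m where "m \<noteq> 0" "singular_relboundary p X S (frag_cmul m c')"
    by (auto simp: relboundaries_of_chain)
  then have "rchain_of_chain (chain_map p f c') \<in> rat_relboundaries p Y T"
    using assms singular_relboundary_chain_map by (metis chain_map_cmul relboundaries_of_chain)
  then have "rchain_scale (of_int k) (rchain_map p f c) \<in> rat_relboundaries p Y T"
    using k by (simp add: rchain_map_scale[symmetric] rchain_map_of_chain)
  then show ?thesis using k by (simp add: subspace_scale_int_iff subspace_relboundaries)
qed

lemma rchain_map_id_on: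
  assumes "singular_rchain p X c" "\<And>x. x \<in> topspace X \<Longrightarrow> f x = x"
  shows "rchain_map p f c = c"
proof -
  have "rchain_map p f c = (\<Sum>s\<in>Poly_Mapping.keys c. Poly_Mapping.single s (Poly_Mapping.lookup c s))"
    unfolding rchain_map_def
  proof (intro sum.cong refl)
    fix s assume "s \<in> Poly_Mapping.keys c"
    then have "singular_simplex p X s" using assms by (auto simp: singular_rchain_def)
    then have "simplex_map p f s = s" using simplex_map_id_gen assms(2) by blast
    then show "Poly_Mapping.single (simplex_map p f s) (Poly_Mapping.lookup c s)
      = Poly_Mapping.single s (Poly_Mapping.lookup c s)" by simp
  qed
  also have "\<dots> = c"
    by (rule poly_mapping_eqI) (auto simp: lookup_sum lookup_single when_def in_keys_iff)
  finally show ?thesis .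
qed

lemma rchain_map_compose: "rchain_map p (g \<circ> f) c = rchain_map p g (rchain_map p f c)"
proof -
  interpret L: Vector_Spaces.linear rchain_scale rchain_scale "rchain_map p g" by (rule linear_rchain_map)
  have "rchain_map p g (Poly_Mapping.single s q) = Poly_Mapping.single (simplex_map p g s) q" for s q
    by (subst rchain_map_superset[of "{s}"]) auto
  then show ?thesis
    by (simp add: rchain_map_def[of p f] rchain_map_def[of p "g \<circ> f"] L.sum simplex_map_compose)
qed

section \<open>Rational Betti numbers of pairs\<close>

lemma rat_relcycles_mono:
  assumes "X \<subseteq> Y" "X \<inter> S \<subseteq> T"
  shows "rat_relcycles p (top_of_set X) S \<subseteq> rat_relcycles p (top_of_set Y) T"
    and "rat_relboundaries p (top_of_set X) S \<subseteq> rat_relboundaries p (top_of_set Y) T"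
proof -
  have mono: "singular_rchain q (top_of_set A) c \<Longrightarrow> singular_rchain q (top_of_set B) c"
    if "A \<subseteq> B" for A B q and c :: "'a rchain"
    using that by (auto simp: singular_rchain_def intro: singular_simplex_mono)
  have "X \<inter> S \<subseteq> Y \<inter> T" using assms by blast
  then have sub: "singular_rchain q (subtopology (top_of_set X) S) c
      \<Longrightarrow> singular_rchain q (subtopology (top_of_set Y) T) c" for q and c :: "'a rchain"
    using mono[of "X \<inter> S" "Y \<inter> T"] by (simp add: subtopology_subtopology)
  show "rat_relcycles p (top_of_set X) S \<subseteq> rat_relcycles p (top_of_set Y) T"
    using mono[OF assms(1)] sub by (auto simp: rat_relcycles_def)
  show "rat_relboundaries p (top_of_set X) S \<subseteq> rat_relboundaries p (top_of_set Y) T"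
    using mono[OF assms(1)] sub unfolding rat_relboundaries_def by blast
qed

definition betti :: "nat \<Rightarrow> 'a::topological_space set \<Rightarrow> 'a set \<Rightarrow> enat" where
  "betti p X S = vdim rat_ring (rat_relative_homology p (top_of_set X) S)"

lemma betti_eq_dim_mod:
  "betti p X S = rchain.dim_mod (rat_relcycles p (top_of_set X) S) (rat_relboundaries p (top_of_set X) S)"
  unfolding betti_def rat_relative_homology_def
  by (intro vdim_quotient_module subspace_relcycles subspace_relboundaries rat_relboundaries_subset)

text \<open>\<open>incl_inj\<close> and \<open>incl_surj\<close> express, on the level of chains, that the map induced by the
  inclusion of \<open>(X, S)\<close> into \<open>(Y, T)\<close> is injective or surjective on rational homology in every
  degree. Both pairs have chains in the same type, so no chain map is needed.\<close>

definition incl_inj :: "'a::topological_space set \<Rightarrow> 'a set \<Rightarrow> 'a set \<Rightarrow> 'a set \<Rightarrow> bool" where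
  "incl_inj X S Y T \<longleftrightarrow> (\<forall>p. \<forall>c\<in>rat_relcycles p (top_of_set X) S.
     c \<in> rat_relboundaries p (top_of_set Y) T \<longrightarrow> c \<in> rat_relboundaries p (top_of_set X) S)"

definition incl_surj :: "'a::topological_space set \<Rightarrow> 'a set \<Rightarrow> 'a set \<Rightarrow> 'a set \<Rightarrow> bool" where
  "incl_surj X S Y T \<longleftrightarrow> (\<forall>p. \<forall>c\<in>rat_relcycles p (top_of_set Y) T.
     \<exists>d\<in>rat_relcycles p (top_of_set X) S. c - d \<in> rat_relboundaries p (top_of_set Y) T)"

lemma incl_surj_trans:
  assumes "incl_surj X S Y T" "incl_surj Y T Z U" "Y \<subseteq> Z" "Y \<inter> T \<subseteq> U"
  shows "incl_surj X S Z U"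
  unfolding incl_surj_def
proof (intro allI ballI)
  fix p c assume "c \<in> rat_relcycles p (top_of_set Z) U"
  then obtain d where d: "d \<in> rat_relcycles p (top_of_set Y) T"
    "c - d \<in> rat_relboundaries p (top_of_set Z) U" using assms(2) by (auto simp: incl_surj_def)
  then obtain e where e: "e \<in> rat_relcycles p (top_of_set X) S"
    "d - e \<in> rat_relboundaries p (top_of_set Y) T" using assms(1) by (auto simp: incl_surj_def)
  then have "d - e \<in> rat_relboundaries p (top_of_set Z) U"
    using rat_relcycles_mono(2)[OF assms(3,4)] by blast
  then have "(c - d) + (d - e) \<in> rat_relboundaries p (top_of_set Z) U"
    using d rchain.subspace_add[OF subspace_relboundaries] by blast
  then show "\<exists>d\<in>rat_relcycles p (top_of_set X) S. c - d \<in> rat_relboundaries p (top_of_set Z) U"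
    using e by auto
qed

lemma betti_incl_eq:
  assumes "X \<subseteq> Y" "X \<inter> S \<subseteq> T" "incl_inj X S Y T" "incl_surj X S Y T"
  shows "betti p X S = betti p Y T"
  unfolding betti_eq_dim_mod
proof (rule rchain.dim_mod_linear[symmetric, where \<phi>=id])
  show "Vector_Spaces.linear rchain_scale rchain_scale (id :: 'a rchain \<Rightarrow> _)"
    by (rule rchain.linear_id)
qed (use assms rat_relcycles_mono[OF assms(1,2), of p]
    in \<open>auto simp: incl_inj_def incl_surj_def subspace_relcycles subspace_relboundaries
      intro: rat_relboundaries_subset[THEN subsetD]\<close>)

text \<open>A rational cycle becomes integral after multiplication by some \<open>k\<close>. For
  injectivity, a second factor \<open>m\<close> turns a rational bounding relation into an integral
  one; for surjectivity, the integral preimage is divided by \<open>k\<close>.\<close>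

lemma incl_iso_of_integer_iso:
  assumes "X \<subseteq> Y" "S \<subseteq> T"
    and iso: "\<And>p. hom_induced (int p) (top_of_set X) S (top_of_set Y) T id
      \<in> iso (relative_homology_group (int p) (top_of_set X) S)
            (relative_homology_group (int p) (top_of_set Y) T)"
  shows "incl_inj X S Y T" "incl_surj X S Y T"
proof -
  have cont: "continuous_map (top_of_set X) (top_of_set Y) id" "id \<in> S \<rightarrow> T"
    using assms by auto
  let ?h = "\<lambda>p. hom_induced (int p) (top_of_set X) S (top_of_set Y) T id"
  have h: "?h p (homologous_rel_set p (top_of_set X) S c) = homologous_rel_set p (top_of_set Y) T c"
    if "singular_relcycle p (top_of_set X) S c" for p c
  proof -
    have "chain_map p id c = c" using that chain_map_ident by (auto simp: singular_relcycle_def)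
    then show ?thesis using hom_induced_chain_map[OF cont that] by simp
  qed
  show "incl_inj X S Y T"
    unfolding incl_inj_def
  proof (intro allI ballI impI)
    fix p c assume c: "c \<in> rat_relcycles p (top_of_set X) S" "c \<in> rat_relboundaries p (top_of_set Y) T"
    obtain k c' where k: "k \<noteq> 0" "rchain_scale (of_int k) c = rchain_of_chain c'"
      by (rule clear_denominators)
    have z: "singular_relcycle p (top_of_set X) S c'"
      using c(1) k relcycles_of_chain rchain.subspace_scale[OF subspace_relcycles] by metis
    have "rchain_of_chain c' \<in> rat_relboundaries p (top_of_set Y) T"
      using c(2) k rchain.subspace_scale[OF subspace_relboundaries] by metis
    then obtain m where m: "m \<noteq> 0" "singular_relboundary p (top_of_set Y) T (frag_cmul m c')"
      by (auto simp: relboundaries_of_chain)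
    let ?d = "frag_cmul m c'"
    have zd: "singular_relcycle p (top_of_set X) S ?d"
      using z by (rule singular_relcycle_cmul)
    have inj: "inj_on (?h p) (carrier (relative_homology_group (int p) (top_of_set X) S))"
      using iso by (auto simp: iso_def bij_betw_def)
    have "?h p (homologous_rel_set p (top_of_set X) S ?d) = ?h p (homologous_rel_set p (top_of_set X) S 0)"
      using h[OF zd] h[OF singular_relcycle_0] m
      by (metis homologous_rel_set_eq_relboundary singular_relboundary_0)
    then have "homologous_rel_set p (top_of_set X) S ?d = homologous_rel_set p (top_of_set X) S 0"
      using inj_onD[OF inj] zd singular_relcycle_0 by (metis carrier_relative_homology_group image_eqI mem_Collect_eq)
    then have "singular_relboundary p (top_of_set X) S ?d"
      by (metis homologous_rel_set_eq_relboundary singular_relboundary_0)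
    then have "rchain_of_chain c' \<in> rat_relboundaries p (top_of_set X) S"
      using m relboundaries_of_chain by blast
    then show "c \<in> rat_relboundaries p (top_of_set X) S"
      using k subspace_scale_int_iff[OF subspace_relboundaries] by metis
  qed
  show "incl_surj X S Y T"
    unfolding incl_surj_def
  proof (intro allI ballI)
    fix p c assume c: "c \<in> rat_relcycles p (top_of_set Y) T"
    obtain k c' where k: "k \<noteq> 0" "rchain_scale (of_int k) c = rchain_of_chain c'"
      by (rule clear_denominators)
    then have z: "singular_relcycle p (top_of_set Y) T c'"
      using c relcycles_of_chain rchain.subspace_scale[OF subspace_relcycles] by metis
    have "?h p ` carrier (relative_homology_group (int p) (top_of_set X) S)
      = carrier (relative_homology_group (int p) (top_of_set Y) T)"
      using iso by (auto simp: iso_def bij_betw_def)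
    then have "homologous_rel_set p (top_of_set Y) T c'
      \<in> ?h p ` carrier (relative_homology_group (int p) (top_of_set X) S)"
      using z by (simp add: carrier_relative_homology_group)
    then obtain d where d: "singular_relcycle p (top_of_set X) S d"
      "homologous_rel_set p (top_of_set Y) T c' = homologous_rel_set p (top_of_set Y) T d"
      using h by (auto simp: carrier_relative_homology_group)
    then have "singular_relboundary p (top_of_set Y) T (c' - d)"
      by (metis homologous_rel_def homologous_rel_set_eq)
    then have "rchain_of_chain (c' - d) \<in> rat_relboundaries p (top_of_set Y) T"
      using relboundaries_of_chain[of "c' - d"] by (metis frag_cmul_one one_neq_zero)
    moreover have "rchain_of_chain (c' - d)
      = rchain_scale (of_int k) (c - rchain_scale (inverse (of_int k)) (rchain_of_chain d))"
      using k by (simp add: rchain_of_chain_diff rchain.scale_right_diff_distrib)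
    ultimately have "c - rchain_scale (inverse (of_int k)) (rchain_of_chain d)
        \<in> rat_relboundaries p (top_of_set Y) T"
      using k subspace_scale_int_iff[OF subspace_relboundaries] by metis
    moreover have "rchain_scale (inverse (of_int k)) (rchain_of_chain d) \<in> rat_relcycles p (top_of_set X) S"
      using d by (intro rchain.subspace_scale subspace_relcycles) (simp add: relcycles_of_chain)
    ultimately show "\<exists>d\<in>rat_relcycles p (top_of_set X) S. c - d \<in> rat_relboundaries p (top_of_set Y) T"
      by blast
  qed
qed

text \<open>With \<open>U\<close> closed and \<open>T\<close> open in \<open>Y\<close>, the
  condition of the excision axiom that the closure of \<open>U\<close> lies in the interior of
  \<open>T\<close> reduces to \<open>U \<subseteq> T\<close>.\<close>

lemma incl_iso_excision:
  assumes "openin (top_of_set Y) T" "closedin (top_of_set Y) U" "U \<subseteq> T"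
  shows "incl_inj (Y - U) (T - U) Y T" "incl_surj (Y - U) (T - U) Y T"
proof -
  have T: "T \<subseteq> Y" using assms(1) openin_imp_subset by blast
  have "hom_induced (int p) (top_of_set (Y - U)) (T - U) (top_of_set Y) T id
      \<in> iso (relative_homology_group (int p) (top_of_set (Y - U)) (T - U))
            (relative_homology_group (int p) (top_of_set Y) T)" for p
  proof -
    have "top_of_set Y closure_of U \<subseteq> top_of_set Y interior_of T"
      using assms by (simp add: closure_of_closedin interior_of_openin)
    from homology_excision_axiom[OF this T, of "int p"]
    show ?thesis by (simp add: subtopology_subtopology Int_absorb1)
  qed
  then show "incl_inj (Y - U) (T - U) Y T" "incl_surj (Y - U) (T - U) Y T"
    by (rule incl_iso_of_integer_iso[OF Diff_subset Diff_subset])+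
qed

text \<open>The end map \<open>h (1, _)\<close> is a homotopy inverse of the inclusion of pairs. The
  homotopy may move points of \<open>X\<close> as long as it preserves all four sets, which makes
  this a weak form of deformation retraction.\<close>

lemma incl_iso_deformation:
  fixes h :: "real \<times> 'a::topological_space \<Rightarrow> 'a"
  assumes sub: "X \<subseteq> Y" "S \<subseteq> T" "S \<subseteq> X" "T \<subseteq> Y"
    and cont: "continuous_on ({0..1} \<times> Y) h"
    and h0: "\<And>y. y \<in> Y \<Longrightarrow> h (0, y) = y"
    and hY: "\<And>t y. 0 \<le> t \<Longrightarrow> t \<le> 1 \<Longrightarrow> y \<in> Y \<Longrightarrow> h (t, y) \<in> Y"
    and hT: "\<And>t y. 0 \<le> t \<Longrightarrow> t \<le> 1 \<Longrightarrow> y \<in> T \<Longrightarrow> h (t, y) \<in> T"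
    and hX: "\<And>t y. 0 \<le> t \<Longrightarrow> t \<le> 1 \<Longrightarrow> y \<in> X \<Longrightarrow> h (t, y) \<in> X"
    and hS: "\<And>t y. 0 \<le> t \<Longrightarrow> t \<le> 1 \<Longrightarrow> y \<in> S \<Longrightarrow> h (t, y) \<in> S"
    and h1: "\<And>y. y \<in> Y \<Longrightarrow> h (1, y) \<in> X" "\<And>y. y \<in> T \<Longrightarrow> h (1, y) \<in> S"
  shows "incl_inj X S Y T" "incl_surj X S Y T"
proof -
  have contXY: "continuous_map (top_of_set X) (top_of_set Y) id" using sub by auto
  have contYX: "continuous_map (top_of_set Y) (top_of_set X) (\<lambda>y. h (1, y))"
    using h1 by (auto intro!: continuous_on_compose2[OF cont] continuous_intros)
  have homotopy: "homotopic_with (\<lambda>k. k \<in> B \<rightarrow> B) (top_of_set A) (top_of_set A) id (\<lambda>y. h (1, y))"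
    if A: "A \<subseteq> Y" "B \<subseteq> A" and hA: "\<And>t y. 0 \<le> t \<Longrightarrow> t \<le> 1 \<Longrightarrow> y \<in> A \<Longrightarrow> h (t, y) \<in> A"
      and hB: "\<And>t y. 0 \<le> t \<Longrightarrow> t \<le> 1 \<Longrightarrow> y \<in> B \<Longrightarrow> h (t, y) \<in> B" for A B
  proof -
    have "homotopic_with (\<lambda>k. k \<in> B \<rightarrow> B) (top_of_set A) (top_of_set A) (\<lambda>y. h (0, y)) (\<lambda>y. h (1, y))"
      unfolding homotopic_with_def
    proof (intro exI[of _ h] conjI allI ballI)
      have "continuous_on ({0..1} \<times> A) h" using A by (intro continuous_on_subset[OF cont]) auto
      then show "continuous_map (prod_topology (top_of_set {0..1}) (top_of_set A)) (top_of_set A) h"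
        using hA by auto
    qed (use hB in auto)
    then show ?thesis
      by (rule homotopic_with_eq) (use A h0 in \<open>auto simp: Pi_iff subset_iff\<close>)
  qed
  have "hom_induced (int p) (top_of_set X) S (top_of_set Y) T id
      \<in> iso (relative_homology_group (int p) (top_of_set X) S)
            (relative_homology_group (int p) (top_of_set Y) T)" for p
  proof (rule homotopy_equivalence_relative_homology_group_isomorphism[OF contXY _ contYX])
    show "homotopic_with (\<lambda>k. k \<in> S \<rightarrow> S) (top_of_set X) (top_of_set X) ((\<lambda>y. h (1, y)) \<circ> id) id"
      using homotopy[of X S] sub hX hS by (simp add: homotopic_with_symD)
    show "homotopic_with (\<lambda>k. k \<in> T \<rightarrow> T) (top_of_set Y) (top_of_set Y) (id \<circ> (\<lambda>y. h (1, y))) id"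
      using homotopy[of Y T] sub hY hT by (simp add: homotopic_with_symD)
  qed (use sub h1 in auto)
  then show "incl_inj X S Y T" "incl_surj X S Y T"
    by (rule incl_iso_of_integer_iso[OF sub(1,2)])+
qed

text \<open>The chain map of \<open>r\<close> is its own inverse on singular chains, so it is an
  isomorphism between the chains of the two pairs and no homotopy enters.\<close>

lemma betti_involution:
  fixes r :: "'a::topological_space \<Rightarrow> 'a"
  assumes cont: "continuous_on X r" "continuous_on Y r"
    and img: "r ` X \<subseteq> Y" "r ` Y \<subseteq> X" "r ` S \<subseteq> T" "r ` T \<subseteq> S"
    and inv: "\<And>x. r (r x) = x"
  shows "betti p X S = betti p Y T"
  unfolding betti_eq_dim_mod
proof (rule rchain.dim_mod_linear[symmetric])
  let ?r = "rchain_map p r"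
  have XY: "continuous_map (top_of_set X) (top_of_set Y) r" "r \<in> S \<rightarrow> T"
    and YX: "continuous_map (top_of_set Y) (top_of_set X) r" "r \<in> T \<rightarrow> S"
    using cont img by auto
  have rr: "?r (?r c) = c" if "singular_rchain p Z c" for c Z
    using rchain_map_id_on[OF that, of "r \<circ> r"] inv by (simp add: rchain_map_compose)
  show "Vector_Spaces.linear rchain_scale rchain_scale ?r" by (rule linear_rchain_map)
  show "?r c \<in> rat_relcycles p (top_of_set Y) T" if "c \<in> rat_relcycles p (top_of_set X) S" for c
    using rchain_map_relcycles[OF XY that] .
  show "?r c \<in> rat_relboundaries p (top_of_set Y) T" if "c \<in> rat_relboundaries p (top_of_set X) S" for c
    using rchain_map_relboundaries[OF XY that] .
  show "c \<in> rat_relboundaries p (top_of_set X) S"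
    if "c \<in> rat_relcycles p (top_of_set X) S" "?r c \<in> rat_relboundaries p (top_of_set Y) T" for c
    using rchain_map_relboundaries[OF YX that(2)] rr[of "top_of_set X" c] that(1)
    by (simp add: rat_relcycles_def)
  show "\<exists>c\<in>rat_relcycles p (top_of_set X) S. d - ?r c \<in> rat_relboundaries p (top_of_set Y) T"
    if "d \<in> rat_relcycles p (top_of_set Y) T" for d
    using rchain_map_relcycles[OF YX that] rr[of "top_of_set Y" d] that
      rchain.subspace_0[OF subspace_relboundaries]
    by (intro bexI[of _ "?r d"]) (auto simp: rat_relcycles_def)
qed (simp_all add: subspace_relcycles subspace_relboundaries rat_relboundaries_subset)

section \<open>Splitting the homology of a triple\<close>

text \<open>Injectivity in every degree makes the connecting homomorphisms of the triple vanish, so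
  its long exact sequence breaks into short ones, to which \<open>dim_mod_add\<close> applies.
  Exactness is verified directly on chains.\<close>

lemma betti_triple:
  assumes sub: "S \<subseteq> T" "T \<subseteq> X" and inj: "incl_inj T S X S"
  shows "betti p X S = betti p T S + betti p X T"
  unfolding betti_eq_dim_mod
proof (rule rchain.dim_mod_add)
  have XT: "subtopology (top_of_set X) T = top_of_set T" "subtopology (top_of_set X) S = top_of_set S"
    "subtopology (top_of_set T) S = top_of_set S"
    using sub by (auto simp: subtopology_subtopology Int_absorb1)
  have mono: "singular_rchain q (top_of_set A) c \<Longrightarrow> singular_rchain q (top_of_set B) c"
    if "A \<subseteq> B" for A B q and c :: "'a rchain"
    using that by (auto simp: singular_rchain_def intro: singular_simplex_mono)
  have neg: "singular_rchain q Z (- c)" if "singular_rchain q Z c" for q Z and c :: "'a rchain"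
    using singular_rchain_scale[OF that, of "-1"] by simp
  have zero: "rchain_boundary p 0 = (0 :: 'a rchain)" for p by (simp add: rchain_boundary_def)
  have chain_boundary: "e \<in> rat_relboundaries q (top_of_set X) T"
    if "singular_rchain q (top_of_set T) e" for q e
    using neg[OF that] by (auto simp: rat_relboundaries_def XT zero intro!: exI[of _ 0])
  let ?Z1 = "rat_relcycles p (top_of_set T) S" and ?N1 = "rat_relboundaries p (top_of_set T) S"
    and ?Z2 = "rat_relcycles p (top_of_set X) S" and ?N2 = "rat_relboundaries p (top_of_set X) S"
    and ?Z3 = "rat_relcycles p (top_of_set X) T" and ?N3 = "rat_relboundaries p (top_of_set X) T"
  show "?Z1 \<subseteq> ?Z2" "?N1 \<subseteq> ?N2" "?N2 \<subseteq> ?N3" "?Z2 \<subseteq> ?Z3"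
    using sub by (intro rat_relcycles_mono; blast)+
  show "?Z1 \<subseteq> ?N3"
    using chain_boundary by (auto simp: rat_relcycles_def)
  show "x \<in> ?N1" if "x \<in> ?Z1" "x \<in> ?N2" for x
    using inj that by (auto simp: incl_inj_def)
  show "\<exists>z\<in>?Z1. x - z \<in> ?N2" if x: "x \<in> ?Z2" "x \<in> ?N3" for x
  proof -
    obtain d where d: "singular_rchain (Suc p) (top_of_set X) d"
      "singular_rchain p (top_of_set T) (rchain_boundary (Suc p) d - x)"
      using x(2) by (auto simp: rat_relboundaries_def XT)
    \<comment> \<open>Subtracting a boundary does not change the class in \<open>X\<close>, and it
      moves \<open>x\<close> to a chain in \<open>T\<close>.\<close>
    define z where "z = x - rchain_boundary (Suc p) d"
    have "rchain_boundary p (rchain_boundary (Suc p) d) = 0"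
      using rchain_boundary_boundary[OF d(1)] by simp
    moreover have "x = z + rchain_boundary (Suc p) d" by (simp add: z_def)
    ultimately have "rchain_boundary p z = rchain_boundary p x"
      using rchain_boundary_add[of p z "rchain_boundary (Suc p) d"] by simp
    moreover have "singular_rchain p (top_of_set T) z" using neg[OF d(2)] by (simp add: z_def)
    ultimately have "z \<in> ?Z1" using x(1) by (simp add: rat_relcycles_def XT)
    moreover have "x - z \<in> ?N2"
      using d(1) by (auto simp: rat_relboundaries_def z_def intro!: exI[of _ d])
    ultimately show ?thesis by blast
  qed
  show "\<exists>z\<in>?Z2. x - z \<in> ?N3" if x: "x \<in> ?Z3" for x
  \<comment> \<open>In degree 0 every chain has zero boundary, so \<open>x\<close> is already a
    cycle relative to \<open>S\<close>; truncated subtraction in \<open>p - 1\<close> calls for the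
    separate case.\<close>
  proof (cases "p = 0")
    case True
    then have "x \<in> ?Z2" using x by (simp add: rat_relcycles_def rchain_boundary_def)
    then show ?thesis using rchain.subspace_0[OF subspace_relboundaries] by (intro bexI[of _ x]) auto
  next
    case False
    have xX: "singular_rchain p (top_of_set X) x"
      and xT: "singular_rchain (p - 1) (top_of_set T) (rchain_boundary p x)"
      using x by (auto simp: rat_relcycles_def XT)
    \<comment> \<open>The boundary of \<open>x\<close> represents its image under the connecting
      homomorphism. It bounds in \<open>X\<close>, hence by injectivity it bounds modulo
      \<open>S\<close> a chain \<open>e\<close> in \<open>T\<close>, and \<open>x - e\<close> is the
      required lift.\<close>
    have "rchain_boundary p x \<in> rat_relcycles (p - 1) (top_of_set T) S"
      using xT rchain_boundary_boundary[OF xX] by (simp add: rat_relcycles_def)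
    moreover have "rchain_boundary p x \<in> rat_relboundaries (p - 1) (top_of_set X) S"
      using xX False by (auto simp: rat_relboundaries_def intro!: exI[of _ x])
    ultimately have "rchain_boundary p x \<in> rat_relboundaries (p - 1) (top_of_set T) S"
      using inj by (auto simp: incl_inj_def)
    then obtain e where e: "singular_rchain p (top_of_set T) e"
      "singular_rchain (p - 1) (top_of_set S) (rchain_boundary p e - rchain_boundary p x)"
      using False by (auto simp: rat_relboundaries_def XT)
    have "x = (x - e) + e" by simp
    then have "rchain_boundary p (x - e) = rchain_boundary p x - rchain_boundary p e"
      using rchain_boundary_add[of p "x - e" e] by simp
    then have "singular_rchain (p - 1) (top_of_set S) (rchain_boundary p (x - e))"
      using neg[OF e(2)] by simp
    moreover have "singular_rchain p (top_of_set X) (x - e)"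
      using xX mono[OF sub(2) e(1)] by (rule singular_rchain_diff)
    ultimately have "x - e \<in> ?Z2" by (simp add: rat_relcycles_def XT)
    moreover have "x - (x - e) \<in> ?N3" using chain_boundary[OF e(1)] by simp
    ultimately show ?thesis by blast
  qed
qed (simp_all add: subspace_relcycles subspace_relboundaries rat_relboundaries_subset)

text \<open>A class of \<open>(T, S)\<close> that dies in \<open>(X, S)\<close> is represented by a
  cycle \<open>d\<close> of \<open>(A, B)\<close>. The retraction fixes \<open>d\<close> and carries
  the chains that show it to bound into \<open>(A, B)\<close>, so the class was already
  zero.\<close>

lemma betti_split:
  assumes sub: "S \<subseteq> T" "T \<subseteq> X" "A \<subseteq> T" "B \<subseteq> S"
    and surj: "incl_surj A B T S"
    and retr: "continuous_on X \<rho>" "\<rho> ` X \<subseteq> A" "\<rho> ` S \<subseteq> B" "\<And>x. x \<in> A \<Longrightarrow> \<rho> x = x"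
  shows "betti p X S = betti p T S + betti p X T"
proof (rule betti_triple[OF sub(1,2)])
  show "incl_inj T S X S"
    unfolding incl_inj_def
  proof (intro allI ballI impI)
    fix p c assume c: "c \<in> rat_relcycles p (top_of_set T) S" "c \<in> rat_relboundaries p (top_of_set X) S"
    then obtain d where d: "d \<in> rat_relcycles p (top_of_set A) B"
      "c - d \<in> rat_relboundaries p (top_of_set T) S" using surj by (auto simp: incl_surj_def)
    have "c - d \<in> rat_relboundaries p (top_of_set X) S"
      using d(2) rat_relcycles_mono(2)[of T X S S p] sub by auto
    then have "c - (c - d) \<in> rat_relboundaries p (top_of_set X) S"
      using c(2) rchain.subspace_diff[OF subspace_relboundaries] by blast
    then have "rchain_map p \<rho> d \<in> rat_relboundaries p (top_of_set A) B"
      using retr by (intro rchain_map_relboundaries) auto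
    moreover have "rchain_map p \<rho> d = d"
      using d(1) retr(4) by (intro rchain_map_id_on[of p "top_of_set A"]) (auto simp: rat_relcycles_def)
    ultimately have "d \<in> rat_relboundaries p (top_of_set T) S"
      using rat_relcycles_mono(2)[of A T B S p] sub by auto
    then have "(c - d) + d \<in> rat_relboundaries p (top_of_set T) S"
      using d(2) rchain.subspace_add[OF subspace_relboundaries] by blast
    then show "c \<in> rat_relboundaries p (top_of_set T) S" by simp
  qed
qed

lemma betti_self: "betti p X X = 0"
proof -
  have "rat_relboundaries p (top_of_set X) X = rat_relcycles p (top_of_set X) X"
  proof
    show "rat_relcycles p (top_of_set X) X \<subseteq> rat_relboundaries p (top_of_set X) X"
    proof
      fix c assume "c \<in> rat_relcycles p (top_of_set X) X"
      then have "singular_rchain p (top_of_set X) (rchain_scale (- 1) c)"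
        by (intro singular_rchain_scale) (simp add: rat_relcycles_def)
      then show "c \<in> rat_relboundaries p (top_of_set X) X"
        by (auto simp: rat_relboundaries_def rchain_boundary_def subtopology_subtopology intro!: exI[of _ 0])
    qed
  qed (rule rat_relboundaries_subset)
  then show ?thesis
    by (simp add: betti_eq_dim_mod rchain.dim_mod_self subspace_relcycles)
qed

text \<open>The hypotheses make the homology of \<open>(T, S)\<close> vanish, so the triple
  contributes only its quotient term.\<close>

lemma betti_change_subspace:
  assumes sub: "S \<subseteq> T" "T \<subseteq> X" and iso: "incl_inj S S T S" "incl_surj S S T S"
  shows "betti p X S = betti p X T"
proof -
  have z: "c \<in> rat_relboundaries q (top_of_set T) S" if c: "c \<in> rat_relcycles q (top_of_set T) S" for q c
  proof -
    obtain d where d: "d \<in> rat_relcycles q (top_of_set S) S" "c - d \<in> rat_relboundaries q (top_of_set T) S"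
      using iso c by (auto simp: incl_surj_def)
    then have "singular_rchain q (top_of_set S) (rchain_scale (- 1) d)"
      by (intro singular_rchain_scale) (simp add: rat_relcycles_def)
    then have "d \<in> rat_relboundaries q (top_of_set T) S"
      using sub by (auto simp: rat_relboundaries_def rchain_boundary_def subtopology_subtopology Int_absorb1
          intro!: exI[of _ 0])
    then have "(c - d) + d \<in> rat_relboundaries q (top_of_set T) S"
      using d(2) rchain.subspace_add[OF subspace_relboundaries] by blast
    then show ?thesis by simp
  qed
  have "betti p X S = betti p T S + betti p X T"
    using z by (intro betti_triple sub) (auto simp: incl_inj_def)
  moreover have "betti p T S = 0"
    using betti_incl_eq[of S T S S p] iso sub betti_self[of p S] by (metis inf_le2)
  ultimately show ?thesis by simp
qed

section \<open>Separated index sets\<close>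

definition sep :: "'n::finite set \<Rightarrow> real ^ 'n \<Rightarrow> bool" where
  "sep H z \<longleftrightarrow> (\<forall>i\<in>H. z $ i \<noteq> 0 \<and> (\<forall>j\<in>- H. \<bar>z $ j\<bar> < \<bar>z $ i\<bar>))"

definition Uset :: "('n::finite set \<Rightarrow> bool) \<Rightarrow> (real ^ 'n) set" where
  "Uset F = {z. \<exists>H. H \<noteq> {} \<and> F H \<and> sep H z}"

definition Cset :: "('n::finite set \<Rightarrow> bool) \<Rightarrow> (real ^ 'n) set" where
  "Cset F = {z. z \<noteq> 0 \<and> (\<forall>H. H \<noteq> {} \<longrightarrow> sep H z \<longrightarrow> F H)}"

text \<open>For intermediate \<open>S\<close> this is the region left after folding the coordinates
  in \<open>S\<close>; the other coordinates keep both signs.\<close>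

definition orthant :: "'n::finite set \<Rightarrow> (real ^ 'n) set" where
  "orthant S = {z. \<forall>i\<in>S. 0 \<le> z $ i}"

lemma sep_cong_abs: "(\<And>i. \<bar>z $ i\<bar> = \<bar>w $ i\<bar>) \<Longrightarrow> sep H z \<longleftrightarrow> sep H w"
  unfolding sep_def by (metis abs_eq_0)

lemma sep_up: "sep H z \<Longrightarrow> i \<in> H \<Longrightarrow> \<bar>z $ i\<bar> \<le> \<bar>z $ j\<bar> \<Longrightarrow> j \<in> H"
  unfolding sep_def by (metis ComplI not_less)

text \<open>Separated sets are closed upwards for the order of the indices by the modulus of their
  coordinates, so two of them cannot be incomparable.\<close>

lemma sep_linear:
  assumes "sep H z" "sep G z"
  shows "H \<subseteq> G \<or> G \<subseteq> H"
proof (rule ccontr)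
  assume "\<not> ?thesis"
  then obtain i j where "i \<in> H" "i \<notin> G" "j \<in> G" "j \<notin> H" by blast
  then show False using assms unfolding sep_def by (metis ComplI less_asym)
qed

lemma sep_support: "sep {i. z $ i \<noteq> 0} z"
  by (auto simp: sep_def)

lemma sep_scaleR: "c \<noteq> 0 \<Longrightarrow> sep H (c *\<^sub>R z) \<longleftrightarrow> sep H z"
  by (simp add: sep_def abs_mult)

lemma support_nonempty: "z \<noteq> 0 \<Longrightarrow> {i. z $ i \<noteq> 0} \<noteq> {}"
  by (auto simp: vec_eq_iff)

lemma Cset_subset_Uset: "Cset F \<subseteq> Uset F"
proof
  fix z assume "z \<in> Cset F"
  then have "F {i. z $ i \<noteq> 0}" "z \<noteq> 0" using sep_support[of z] support_nonempty[of z] by (auto simp: Cset_def)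
  then show "z \<in> Uset F" unfolding Uset_def
    by (intro CollectI exI[of _ "{i. z $ i \<noteq> 0}"] conjI sep_support support_nonempty)
qed

lemma zero_notin_Uset: "0 \<notin> Uset F"
  by (auto simp: Uset_def sep_def)

lemma Uset_mono: "(\<And>H. G H \<Longrightarrow> F H) \<Longrightarrow> Uset G \<subseteq> Uset F"
  by (auto simp: Uset_def)

lemma Cset_mono: "(\<And>H. G H \<Longrightarrow> F H) \<Longrightarrow> Cset G \<subseteq> Cset F"
  by (auto simp: Cset_def)

lemma open_sep: "open {z. sep H z}"
proof -
  have "{z. sep H z} = (\<Inter>i\<in>H. {z. z $ i \<noteq> 0} \<inter> (\<Inter>j\<in>- H. {z. \<bar>z $ j\<bar> < \<bar>z $ i\<bar>}))"
    by (auto simp: sep_def)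
  moreover have "open \<dots>"
    by (intro open_INT open_Int ballI finite open_Collect_neq open_Collect_less continuous_intros)
  ultimately show ?thesis by simp
qed

lemma open_Uset: "open (Uset F)"
proof -
  have "Uset F = (\<Union>H\<in>{H. H \<noteq> {} \<and> F H}. {z. sep H z})" by (auto simp: Uset_def)
  then show ?thesis using open_sep by (metis (no_types, lifting) open_UN)
qed

text \<open>\<open>sep_weight H\<close> plays the role of the barycentric coordinate of the vertex \<open>H\<close>; only its
  continuity, its positivity set and its bound by the coordinates in \<open>H\<close> matter.\<close>

definition sep_weight :: "'n::finite set \<Rightarrow> real ^ 'n \<Rightarrow> real" where
  "sep_weight H z = (\<Prod>i\<in>H. min 1 \<bar>z $ i\<bar> * (\<Prod>j\<in>- H. min 1 (max 0 (\<bar>z $ i\<bar> - \<bar>z $ j\<bar>))))"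

lemma continuous_on_sep_weight: "continuous_on A (sep_weight H)"
  unfolding sep_weight_def by (intro continuous_intros)

lemma sep_weight_nonneg: "0 \<le> sep_weight H z"
  unfolding sep_weight_def by (intro prod_nonneg mult_nonneg_nonneg) auto

lemma sep_weight_pos_iff: "0 < sep_weight H z \<longleftrightarrow> sep H z"
proof -
  have "sep_weight H z \<noteq> 0 \<longleftrightarrow> sep H z"
  proof -
    have "min 1 \<bar>x\<bar> \<noteq> 0 \<longleftrightarrow> x \<noteq> 0" "min 1 (max 0 (a - b)) \<noteq> 0 \<longleftrightarrow> b < a" for x a b :: real
      by (auto simp: min_def max_def)
    then show ?thesis by (simp add: sep_weight_def sep_def prod_zero_iff)
  qed
  then show ?thesis using sep_weight_nonneg[of H z] by linarith
qed

text \<open>All factors of the weight lie between 0 and 1, so the product is bounded by its single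
  factor \<open>min 1 \<bar>z $ i\<bar>\<close>.\<close>

lemma sep_weight_le:
  assumes "i \<in> H"
  shows "sep_weight H z \<le> \<bar>z $ i\<bar>"
proof -
  define P where "P = (\<lambda>k. \<Prod>j\<in>- H. min 1 (max 0 (\<bar>z $ k\<bar> - \<bar>z $ j\<bar>)))"
  have P: "0 \<le> P k" "P k \<le> 1" for k
    unfolding P_def by (rule prod_nonneg, simp) (rule prod_le_1, simp)
  have f0: "0 \<le> min 1 \<bar>z $ k\<bar> * P k" for k
    using P by simp
  have f1: "min 1 \<bar>z $ k\<bar> * P k \<le> 1" for k
    using P by (intro mult_le_one) auto
  have "sep_weight H z = min 1 \<bar>z $ i\<bar> * (P i * (\<Prod>k\<in>H - {i}. min 1 \<bar>z $ k\<bar> * P k))"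
    unfolding sep_weight_def P_def[symmetric] prod.remove[OF finite assms] by (simp add: mult.assoc P_def)
  also have "\<dots> \<le> min 1 \<bar>z $ i\<bar>"
  proof (rule mult_left_le)
    show "P i * (\<Prod>k\<in>H - {i}. min 1 \<bar>z $ k\<bar> * P k) \<le> 1"
      by (intro mult_le_one P prod_nonneg prod_le_1) (use f0 f1 in auto)
  qed simp
  finally show ?thesis by simp
qed

lemma sep_weight_eq_0: "\<not> sep H z \<Longrightarrow> sep_weight H z = 0"
  using sep_weight_pos_iff[of H z] sep_weight_nonneg[of H z] by linarith

section \<open>The deformation that removes the weights outside \<open>F\<close>\<close>

text \<open>The \<open>i\<close>-th coordinate of the combination of the indicator vectors of the
  members of \<open>F\<close>, with \<open>sep_weight\<close> as coefficients.\<close>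

definition coweight :: "('n::finite set \<Rightarrow> bool) \<Rightarrow> 'n \<Rightarrow> real ^ 'n \<Rightarrow> real" where
  "coweight F i z = (\<Sum>H | i \<in> H \<and> F H. sep_weight H z)"

lemma coweight_nonneg: "0 \<le> coweight F i z"
  unfolding coweight_def by (intro sum_nonneg sep_weight_nonneg)

lemma coweight_eq_0:
  assumes "z $ i = 0"
  shows "coweight F i z = 0"
  unfolding coweight_def using assms by (intro sum.neutral ballI sep_weight_eq_0) (auto simp: sep_def)

lemma coweight_ge: "i \<in> H \<Longrightarrow> F H \<Longrightarrow> sep_weight H z \<le> coweight F i z"
  unfolding coweight_def
  by (rule member_le_sum[where f="\<lambda>H. sep_weight H z"]) (simp_all add: sep_weight_nonneg)

text \<open>By \<open>sep_up\<close>, every separated set that contains \<open>i\<close> contains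
  \<open>j\<close> too, so each nonzero summand on the left recurs on the right.\<close>

lemma coweight_mono:
  assumes "\<bar>z $ i\<bar> \<le> \<bar>z $ j\<bar>"
  shows "coweight F i z \<le> coweight F j z"
proof -
  have "coweight F i z = (\<Sum>H | i \<in> H \<and> j \<in> H \<and> F H. sep_weight H z)"
    unfolding coweight_def using assms
    by (intro sum.mono_neutral_right ballI sep_weight_eq_0) (auto dest: sep_up)
  also have "\<dots> \<le> coweight F j z"
    unfolding coweight_def by (intro sum_mono2) (auto simp: sep_weight_nonneg)
  finally show ?thesis .
qed

text \<open>The straight line from \<open>z\<close> to the vector with the signs of \<open>z\<close>
  and the moduli \<open>coweight F i z\<close>. Keeping the signs makes it compatible with the
  orthants.\<close>

definition kill :: "('n::finite set \<Rightarrow> bool) \<Rightarrow> real \<times> (real ^ 'n) \<Rightarrow> real ^ 'n" where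
  "kill F = (\<lambda>(s, z). \<chi> i. (1 - s) * z $ i + s * (sgn (z $ i) * coweight F i z))"

text \<open>The sign jumps only where \<open>u\<close> vanishes, and there the factor
  \<open>g\<close> vanishes as well.\<close>

lemma continuous_on_sgn_mult:
  fixes g :: "'a::topological_space \<Rightarrow> real"
  assumes u: "continuous_on UNIV u" and g: "continuous_on UNIV g" and 0: "\<And>x. u x = 0 \<Longrightarrow> g x = 0"
  shows "continuous_on UNIV (\<lambda>x. sgn (u x) * g x)"
proof -
  have "continuous_on ({x. 0 \<le> u x} \<union> {x. u x \<le> 0}) (\<lambda>x. if 0 \<le> u x then g x else - g x)"
    using 0 by (intro continuous_on_cases closed_Collect_le continuous_intros u
        continuous_on_subset[OF g] continuous_on_minus) auto
  moreover have "{x. 0 \<le> u x} \<union> {x. u x \<le> 0} = UNIV" by auto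
  moreover have "(\<lambda>x. if 0 \<le> u x then g x else - g x) = (\<lambda>x. sgn (u x) * g x)"
    using 0 by (auto simp: sgn_if)
  ultimately show ?thesis by metis
qed

lemma continuous_on_kill: "continuous_on A (kill F)"
proof -
  have c: "continuous_on UNIV (coweight F i)" for i
    unfolding coweight_def by (intro continuous_intros continuous_on_sep_weight)
  have "continuous_on UNIV (\<lambda>z. sgn (z $ i) * coweight F i z)" for i
    by (intro continuous_on_sgn_mult c coweight_eq_0 continuous_intros)
  then have *: "continuous_on A (\<lambda>p. sgn (snd p $ i) * coweight F i (snd p))" for i
    by (rule continuous_on_compose2) (auto intro: continuous_intros)
  have "continuous_on A (\<lambda>p. (1 - fst p) * snd p $ i + fst p * (sgn (snd p $ i) * coweight F i (snd p)))" for i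
    by (rule continuous_on_add[OF continuous_on_mult continuous_on_mult[OF _ *[of i]]])
      (intro continuous_intros)+
  then show ?thesis
    unfolding kill_def case_prod_beta by (rule continuous_on_vec_lambda)
qed

lemma kill_0: "kill F (0, z) = z"
  by (simp add: kill_def vec_eq_iff)

context
  fixes F :: "'n::finite set \<Rightarrow> bool" and s :: real
  assumes s: "0 \<le> s" "s \<le> 1"
begin

text \<open>Both ends of the line have the sign of \<open>z $ i\<close> or are zero in this
  coordinate, so moduli are interpolated without cancellation.\<close>

lemma abs_kill: "\<bar>kill F (s, z) $ i\<bar> = (1 - s) * \<bar>z $ i\<bar> + s * coweight F i z"
proof (cases "z $ i = 0")
  case False
  have "kill F (s, z) $ i = sgn (z $ i) * ((1 - s) * \<bar>z $ i\<bar> + s * coweight F i z)"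
    by (simp add: kill_def distrib_left mult.left_commute[of "sgn _"] sgn_mult_abs)
  moreover have "0 \<le> (1 - s) * \<bar>z $ i\<bar> + s * coweight F i z"
    using s coweight_nonneg by (intro add_nonneg_nonneg mult_nonneg_nonneg) auto
  ultimately show ?thesis using False by (simp add: abs_mult abs_sgn_eq)
qed (simp add: kill_def coweight_eq_0)

lemma abs_kill_mono: "\<bar>z $ i\<bar> \<le> \<bar>z $ j\<bar> \<Longrightarrow> \<bar>kill F (s, z) $ i\<bar> \<le> \<bar>kill F (s, z) $ j\<bar>"
  using s coweight_mono[of z i j F] by (simp add: abs_kill add_mono mult_left_mono)

text \<open>The deformation preserves weak inequalities between moduli and keeps zero coordinates
  zero, so no new separated set can arise.\<close>

lemma sep_kill_imp:
  assumes "sep H (kill F (s, z))"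
  shows "sep H z"
  unfolding sep_def
proof (intro ballI conjI)
  fix i assume i: "i \<in> H"
  show "z $ i \<noteq> 0"
    using abs_kill[of z i] assms i by (auto simp: sep_def coweight_eq_0)
  show "\<bar>z $ j\<bar> < \<bar>z $ i\<bar>" if "j \<in> - H" for j
  proof (rule ccontr)
    assume "\<not> ?thesis"
    then have "\<bar>kill F (s, z) $ i\<bar> \<le> \<bar>kill F (s, z) $ j\<bar>" by (intro abs_kill_mono) simp
    then show False using sep_up[OF assms i] that by blast
  qed
qed

text \<open>The weight of \<open>H\<close> itself counts for every coordinate inside
  \<open>H\<close> and for none outside. This keeps the gap open at \<open>s = 1\<close>; for
  smaller \<open>s\<close> the gap in \<open>z\<close> already suffices.\<close>

lemma sep_killI:
  assumes H: "H \<noteq> {}" "F H" "sep H z"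
  shows "sep H (kill F (s, z))"
proof -
  have w: "0 < sep_weight H z" using H sep_weight_pos_iff by blast
  have pos: "0 < \<bar>kill F (s, z) $ i\<bar>" if "i \<in> H" for i
  proof -
    have "0 < \<bar>z $ i\<bar>" "0 < coweight F i z"
      using H that w coweight_ge[of i H F z] by (auto simp: sep_def)
    then show ?thesis using s unfolding abs_kill
      by (cases "s = 1") (auto intro!: add_pos_nonneg)
  qed
  have "\<bar>kill F (s, z) $ j\<bar> < \<bar>kill F (s, z) $ i\<bar>" if i: "i \<in> H" and j: "j \<notin> H" for i j
  proof -
    have lt: "\<bar>z $ j\<bar> < \<bar>z $ i\<bar>" using H i j by (auto simp: sep_def)
    have "coweight F j z + sep_weight H z \<le> coweight F i z"
    proof -
      have "coweight F j z = (\<Sum>G | j \<in> G \<and> i \<in> G \<and> F G. sep_weight G z)"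
        unfolding coweight_def 
        by (intro sum.mono_neutral_right ballI sep_weight_eq_0)
          (auto dest: sep_up[OF _ _ less_imp_le[OF lt]])
      also have "\<dots> + sep_weight H z = (\<Sum>G \<in> insert H {G. j \<in> G \<and> i \<in> G \<and> F G}. sep_weight G z)"
        using j by simp
      also have "\<dots> \<le> coweight F i z"
        unfolding coweight_def using H i by (intro sum_mono2) (auto simp: sep_weight_nonneg)
      finally show ?thesis by simp
    qed
    then have "coweight F j z < coweight F i z" using w by linarith
    then show ?thesis
      using s mult_strict_left_mono[OF lt, of "1 - s"] mult_left_mono[of "coweight F j z" "coweight F i z" s]
      unfolding abs_kill by (cases "s = 1") (auto intro: add_less_le_mono)
  qed
  then show ?thesis using pos by (auto simp: sep_def)
qed

lemma kill_orthant: "z \<in> orthant S \<Longrightarrow> kill F (s, z) \<in> orthant S"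
  using s coweight_nonneg[of F _ z]
  by (auto simp: orthant_def kill_def intro!: add_nonneg_nonneg mult_nonneg_nonneg)

lemma kill_Uset:
  assumes "\<And>H. G H \<Longrightarrow> F H" "z \<in> Uset G"
  shows "kill F (s, z) \<in> Uset G"
proof -
  obtain H where "H \<noteq> {}" "G H" "sep H z" using assms(2) by (auto simp: Uset_def)
  then show ?thesis using sep_killI[of H z] assms(1) unfolding Uset_def by blast
qed

lemma kill_nonzero: "z \<in> Uset F \<Longrightarrow> kill F (s, z) \<noteq> 0"
  using kill_Uset[of F z] zero_notin_Uset[of F] by force

lemma kill_Cset:
  assumes "z \<in> Cset G" "z \<in> Uset F"
  shows "kill F (s, z) \<in> Cset G"
  unfolding Cset_def
proof (intro CollectI conjI allI impI kill_nonzero assms(2))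
  fix H assume "H \<noteq> {}" "sep H (kill F (s, z))"
  then show "G H" using assms(1) sep_kill_imp[of H z] by (auto simp: Cset_def)
qed

end

text \<open>Take the smallest coordinate \<open>i\<close> inside \<open>H\<close> and the largest
  \<open>j\<close> outside. A separated set containing \<open>i\<close> but not \<open>j\<close>
  must be \<open>H\<close>; if \<open>H\<close> is not in \<open>F\<close>, every weight counted at
  \<open>i\<close> is also counted at \<open>j\<close>, contradicting separation at the
  endpoint.\<close>

lemma sep_kill_1:
  assumes H: "H \<noteq> {}" "sep H (kill F (1, z))"
  shows "F H"
proof (rule ccontr)
  assume nF: "\<not> F H"
  have sz: "sep H z" using sep_kill_imp[of 1 H F z] H by simp
  obtain i where i: "i \<in> H" "\<And>k. k \<in> H \<Longrightarrow> \<bar>z $ i\<bar> \<le> \<bar>z $ k\<bar>"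
    using ex_is_arg_min_if_finite[of H "\<lambda>k. \<bar>z $ k\<bar>"] H
    by (auto simp: is_arg_min_linorder)
  have "coweight F i z > 0" using H(2) i(1) abs_kill[of 1 F z i] by (auto simp: sep_def)
  show False
  \<comment> \<open>If \<open>H\<close> contains all indices there is no \<open>j\<close>; then the
    only separated set containing \<open>i\<close> is \<open>H\<close>, and the endpoint would
    vanish at \<open>i\<close>.\<close>
  proof (cases "- H = {}")
    case True
    have "coweight F i z = 0"
      unfolding coweight_def
    proof (intro sum.neutral ballI sep_weight_eq_0 notI)
      fix G assume "G \<in> {G. i \<in> G \<and> F G}" "sep G z"
      then have G: "i \<in> G" "F G" "sep G z" by auto
      have "H \<subseteq> G"
      proof
        fix k assume "k \<in> H"
        then show "k \<in> G" using i(2)[of k] G sep_up by blast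
      qed
      then have "G = H" using True by blast
      then show False using G nF by simp
    qed
    then show False using \<open>coweight F i z > 0\<close> by simp
  next
    case False
    obtain j where j: "j \<notin> H" "\<And>k. k \<notin> H \<Longrightarrow> \<bar>z $ k\<bar> \<le> \<bar>z $ j\<bar>"
      using ex_is_arg_min_if_finite[of "- H" "\<lambda>k. - \<bar>z $ k\<bar>"] False
      by (auto simp: is_arg_min_linorder)
    have "coweight F i z \<le> coweight F j z"
    proof -
      have "coweight F i z = (\<Sum>G | i \<in> G \<and> j \<in> G \<and> F G. sep_weight G z)"
        unfolding coweight_def
      proof (intro sum.mono_neutral_right ballI sep_weight_eq_0 notI)
        fix G assume "G \<in> {G. i \<in> G \<and> F G} - {G. i \<in> G \<and> j \<in> G \<and> F G}" "sep G z"
        then have G: "i \<in> G" "j \<notin> G" "F G" "sep G z" by auto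
        have "H \<subseteq> G"
        proof
          fix k assume "k \<in> H"
          then show "k \<in> G" using i(2)[of k] G sep_up by blast
        qed
        moreover have "G \<subseteq> H"
        proof
          fix k assume "k \<in> G"
          then show "k \<in> H" using j(2)[of k] G sep_up by blast
        qed
        ultimately have "G = H" by blast
        then show False using G nF by simp
      qed auto
      also have "\<dots> \<le> coweight F j z"
        unfolding coweight_def by (intro sum_mono2) (auto simp: sep_weight_nonneg)
      finally show ?thesis .
    qed
    moreover have "\<bar>kill F (1, z) $ j\<bar> < \<bar>kill F (1, z) $ i\<bar>"
      using H(2) i(1) j(1) by (auto simp: sep_def)
    ultimately show False by (simp add: abs_kill)
  qed
qed

lemma kill_1_Cset:
  assumes "z \<in> Uset F"
  shows "kill F (1, z) \<in> Cset F"
  unfolding Cset_def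
proof (intro CollectI conjI allI impI)
  show "kill F (1, z) \<noteq> 0" using assms by (intro kill_nonzero) auto
qed (rule sep_kill_1)

section \<open>Comparison of \<open>Zset\<close>, \<open>Uset\<close>, \<open>Cset\<close> and the
  simplex\<close>

lemma Zset_eq: "Zset f = {z. z \<noteq> 0 \<and> f (\<lambda>i. z $ i \<noteq> 0)}"
proof -
  have "z \<in> stratum x \<longleftrightarrow> x = (\<lambda>i. z $ i \<noteq> 0)" for z :: "real ^ 'a" and x
    by (auto simp: stratum_def)
  moreover have "(\<lambda>i. z $ i \<noteq> 0) = (\<lambda>_. False) \<longleftrightarrow> z = 0" for z :: "real ^ 'a"
    by (auto simp: vec_eq_iff fun_eq_iff)
  ultimately show ?thesis by (auto simp: Zset_def)
qed

lemma Cset_support: "z \<in> Cset F \<Longrightarrow> F {i. z $ i \<noteq> 0}"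
  using sep_support[of z] support_nonempty[of z] by (simp add: Cset_def del: Collect_empty_eq)

text \<open>For a point of \<open>Zset f\<close> the support is a separated member of
  \<open>F\<close>. It stays separated under \<open>kill F\<close>, and zero coordinates stay zero,
  so the support is constant along the deformation.\<close>

lemma betti_Zset:
  fixes f :: "('n::finite \<Rightarrow> bool) \<Rightarrow> bool"
  defines "F \<equiv> \<lambda>H. f (\<lambda>i. i \<in> H)"
  shows "betti p (Zset f) {} = betti p (Uset F) {}"
proof -
  have Z: "Zset f = {z. z \<noteq> 0 \<and> F {i. z $ i \<noteq> 0}}"
    by (simp add: Zset_eq F_def)
  have ZU: "Zset f \<subseteq> Uset F"
  proof
    fix z assume "z \<in> Zset f"
    then show "z \<in> Uset F" unfolding Uset_def Z
      by (intro CollectI exI[of _ "{i. z $ i \<noteq> 0}"] conjI sep_support support_nonempty) auto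
  qed
  have CZ: "Cset F \<subseteq> Zset f"
    using Cset_support[of _ F] by (auto simp: Z) (simp add: Cset_def)
  have keep: "kill F (s, z) \<in> Zset f" if s: "0 \<le> s" "s \<le> 1" and z: "z \<in> Zset f" for s z
  proof -
    let ?H = "{i. z $ i \<noteq> 0}"
    have "sep ?H (kill F (s, z))"
      using z by (intro sep_killI s sep_support support_nonempty) (auto simp: Z)
    moreover have "kill F (s, z) $ i = 0" if "z $ i = 0" for i
      using that by (simp add: kill_def)
    ultimately have "{i. kill F (s, z) $ i \<noteq> 0} = ?H" by (auto simp: sep_def)
    moreover have "kill F (s, z) \<noteq> 0" using kill_nonzero[OF s] z ZU by blast
    ultimately show ?thesis using z by (simp add: Z)
  qed
  have "incl_inj (Zset f) {} (Uset F) {}" "incl_surj (Zset f) {} (Uset F) {}"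
    by (rule incl_iso_deformation[OF ZU _ _ _ continuous_on_kill[of _ F]];
        use keep kill_Uset[of _ F F] kill_1_Cset[of _ F] CZ kill_0[of F] in auto)+
  then show ?thesis using betti_incl_eq[OF ZU] by simp
qed

lemma betti_Uset_Cset:
  assumes GF: "\<And>H. G H \<Longrightarrow> F H"
  shows "betti p (Uset F \<inter> orthant S) (Uset G \<inter> orthant S)
    = betti p (Cset F \<inter> orthant S) (Cset G \<inter> orthant S)"
proof -
  let ?O = "orthant S"
  \<comment> \<open>The deformation \<open>kill F\<close> brings \<open>Uset G\<close> only into
    \<open>Cset F \<inter> Uset G\<close>; a second deformation, \<open>kill G\<close> on this
    intermediate subspace, reaches \<open>Cset G\<close>.\<close>
  let ?M = "Cset F \<inter> Uset G \<inter> ?O"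
  have sub: "Cset F \<inter> ?O \<subseteq> Uset F \<inter> ?O" "?M \<subseteq> Uset G \<inter> ?O" "?M \<subseteq> Cset F \<inter> ?O"
    "Uset G \<inter> ?O \<subseteq> Uset F \<inter> ?O" "Cset G \<inter> ?O \<subseteq> ?M"
    using Cset_subset_Uset Uset_mono[of G F] Cset_mono[of G F] GF by blast+
  have 1: "incl_inj (Cset F \<inter> ?O) ?M (Uset F \<inter> ?O) (Uset G \<inter> ?O)"
    "incl_surj (Cset F \<inter> ?O) ?M (Uset F \<inter> ?O) (Uset G \<inter> ?O)"
    by (rule incl_iso_deformation[OF sub(1-4) continuous_on_kill[of _ F]];
        use GF Cset_subset_Uset[of F] Uset_mono[of G F] in
          \<open>auto simp: kill_0 kill_orthant kill_Uset kill_Cset kill_1_Cset subset_iff\<close>)+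
  have 2: "incl_inj (Cset G \<inter> ?O) (Cset G \<inter> ?O) ?M (Cset G \<inter> ?O)"
    "incl_surj (Cset G \<inter> ?O) (Cset G \<inter> ?O) ?M (Cset G \<inter> ?O)"
    by (rule incl_iso_deformation[OF sub(5) order_refl order_refl sub(5) continuous_on_kill[of _ G]];
        use Cset_subset_Uset[of G] in
          \<open>auto simp: kill_0 kill_orthant kill_Uset kill_Cset kill_1_Cset subset_iff\<close>)+
  have "betti p (Cset F \<inter> ?O) ?M = betti p (Uset F \<inter> ?O) (Uset G \<inter> ?O)"
    using sub(2) by (intro betti_incl_eq[OF sub(1) _ 1]) blast
  then show ?thesis using betti_change_subspace[OF sub(5,3) 2, of p] by simp
qed

lemma orthant_sum_pos:
  assumes "z \<in> orthant UNIV" "z \<noteq> 0"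
  shows "0 < (\<Sum>i\<in>UNIV. z $ i)"
proof -
  obtain i where "z $ i \<noteq> 0" using assms(2) by (auto simp: vec_eq_iff)
  then show ?thesis using assms(1)
    by (intro sum_pos2[of _ i]) (auto simp: orthant_def less_le)
qed

lemma Cset_scaleR: "0 < c \<Longrightarrow> z \<in> Cset F \<Longrightarrow> c *\<^sub>R z \<in> Cset F"
  by (auto simp: Cset_def sep_scaleR)

text \<open>Separation is invariant under positive scaling, so points can be moved radially onto the
  simplex. The factor \<open>c t z\<close> runs from 1 to the reciprocal of the coordinate sum and
  is constantly 1 on the simplex.\<close>

lemma betti_Cset_simplex:
  assumes GF: "\<And>H. G H \<Longrightarrow> F H"
  shows "betti p (Cset F \<inter> orthant UNIV) (Cset G \<inter> orthant UNIV)
    = betti p (Cset F \<inter> std_simplex) (Cset G \<inter> std_simplex)"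
proof -
  have std: "std_simplex = {z. z \<in> orthant UNIV \<and> (\<Sum>i\<in>UNIV. z $ i) = 1}"
    by (auto simp: std_simplex_def orthant_def)
  define c :: "real \<Rightarrow> real ^ 'a \<Rightarrow> real" where "c t z = (1 - t) + t / (\<Sum>i\<in>UNIV. z $ i)" for t z
  define h where "h = (\<lambda>(t, z). c t z *\<^sub>R z)"
  have c1: "c t z = 1" if "z \<in> std_simplex" for t z using that by (simp add: c_def std)
  have cpos: "0 < c t z" if t: "0 \<le> t" "t \<le> 1" and z: "z \<in> orthant UNIV" "z \<noteq> 0" for t z
  proof (cases "t = 0")
    case False
    then have "0 < t / (\<Sum>i\<in>UNIV. z $ i)" using orthant_sum_pos[OF z] t by simp
    then show ?thesis using t by (simp add: c_def)
  qed (simp add: c_def)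
  have C: "h (t, z) \<in> Cset K \<inter> orthant UNIV"
    if t: "0 \<le> t" "t \<le> 1" and z: "z \<in> Cset K \<inter> orthant UNIV" for t z K
  proof -
    have "0 < c t z" using cpos[OF t] z by (auto simp: Cset_def)
    then show ?thesis using z Cset_scaleR by (auto simp: h_def orthant_def)
  qed
  have D: "h (t, z) \<in> Cset K \<inter> std_simplex"
    if "z \<in> Cset K \<inter> std_simplex" for t z K
    using that by (simp add: h_def c1)
  have D1: "h (1, z) \<in> Cset K \<inter> std_simplex" if z: "z \<in> Cset K \<inter> orthant UNIV" for z K
  proof -
    have "(\<Sum>i\<in>UNIV. h (1, z) $ i) = 1"
      using orthant_sum_pos[of z] z by (auto simp: h_def c_def Cset_def sum_divide_distrib[symmetric])
    then show ?thesis using C[of 1 z K] z by (simp add: std)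
  qed
  have cont: "continuous_on ({0..1} \<times> (Cset F \<inter> orthant UNIV)) h"
    unfolding h_def c_def case_prod_beta
    using orthant_sum_pos by (intro continuous_intros) (fastforce simp: Cset_def)
  have sub: "Cset K \<inter> std_simplex \<subseteq> Cset K \<inter> orthant UNIV"
    "Cset G \<inter> std_simplex \<subseteq> Cset F \<inter> std_simplex"
    "Cset G \<inter> orthant UNIV \<subseteq> Cset F \<inter> orthant UNIV" for K
    using Cset_mono[of G F] GF by (auto simp: std)
  have h0: "h (0, z) = z" for z by (simp add: h_def c_def)
  have "incl_inj (Cset F \<inter> std_simplex) (Cset G \<inter> std_simplex) (Cset F \<inter> orthant UNIV) (Cset G \<inter> orthant UNIV)"
    "incl_surj (Cset F \<inter> std_simplex) (Cset G \<inter> std_simplex) (Cset F \<inter> orthant UNIV) (Cset G \<inter> orthant UNIV)"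
    by (rule incl_iso_deformation[OF sub(1,1,2,3) cont]; (rule h0 C D D1; assumption)?)+
  then show ?thesis using betti_incl_eq[OF sub(1)] sub by (metis inf.coboundedI2)
qed

section \<open>Folding along a coordinate hyperplane\<close>

text \<open>On the simplex this condition cuts out the facets indexed by \<open>J\<close>, see
  \<open>Cset_facets\<close>. For empty \<open>J\<close> no set satisfies it, which corresponds to
  absolute homology.\<close>

definition avoid :: "('n set \<Rightarrow> bool) \<Rightarrow> 'n set \<Rightarrow> 'n set \<Rightarrow> bool" where
  "avoid F J H \<longleftrightarrow> F H \<and> \<not> J \<subseteq> H"

definition set_coord :: "'n::finite \<Rightarrow> real \<Rightarrow> real ^ 'n \<Rightarrow> real ^ 'n" where
  "set_coord j a z = (\<chi> i. if i = j then a else z $ i)"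

lemma set_coord_nth [simp]: "set_coord j a z $ i = (if i = j then a else z $ i)"
  by (simp add: set_coord_def)

lemma set_coord_id [simp]: "set_coord j (z $ j) z = z"
  by (simp add: vec_eq_iff)

lemma continuous_on_set_coord:
  assumes "continuous_on A a" "continuous_on A g"
  shows "continuous_on A (\<lambda>x. set_coord j (a x) (g x))"
  unfolding set_coord_def
proof (rule continuous_on_vec_lambda)
  show "continuous_on A (\<lambda>x. if i = j then a x else g x $ i)" for i
    using assms by (cases "i = j") (auto intro: continuous_intros)
qed

lemma sep_set_coord:
  assumes "sep H z" "j \<notin> H" "\<And>i. i \<in> H \<Longrightarrow> \<bar>a\<bar> < \<bar>z $ i\<bar>"
  shows "sep H (set_coord j a z)"
  using assms by (auto simp: sep_def)

lemma sep_set_coord_abs: "\<bar>a\<bar> = \<bar>z $ j\<bar> \<Longrightarrow> sep H (set_coord j a z) \<longleftrightarrow> sep H z"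
  by (rule sep_cong_abs) auto

lemma Uset_set_coord_abs: "\<bar>a\<bar> = \<bar>z $ j\<bar> \<Longrightarrow> set_coord j a z \<in> Uset F \<longleftrightarrow> z \<in> Uset F"
  by (simp add: Uset_def sep_set_coord_abs)

lemma Uset_set_coord:
  assumes "H \<noteq> {}" "F H" "sep H z" "j \<notin> H" "\<And>i. i \<in> H \<Longrightarrow> \<bar>a\<bar> < \<bar>z $ i\<bar>"
  shows "set_coord j a z \<in> Uset F"
  using sep_set_coord[of H z j a] assms unfolding Uset_def by blast

lemma set_coord_orthant: "j \<notin> S \<Longrightarrow> set_coord j a z \<in> orthant S \<longleftrightarrow> z \<in> orthant S"
  by (auto simp: orthant_def)

lemma orthant_insert: "z \<in> orthant (insert j S) \<longleftrightarrow> z \<in> orthant S \<and> 0 \<le> z $ j"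
  by (auto simp: orthant_def)

text \<open>The denominator exceeds the number of index sets, so the height is strictly below any
  positive common bound of the summands.\<close>

definition lift_height :: "('n::finite set \<Rightarrow> bool) \<Rightarrow> 'n \<Rightarrow> real ^ 'n \<Rightarrow> real" where
  "lift_height F j z = (\<Sum>H | H \<noteq> {} \<and> j \<notin> H \<and> F H. sep_weight H z) / (2 ^ CARD('n) + 1)"

lemma continuous_on_lift_height: "continuous_on A (lift_height F j)"
proof -
  have "(2 ^ CARD('a) + 1 :: real) \<noteq> 0" by (intro less_imp_neq[symmetric] add_pos_pos) auto
  then show ?thesis
    unfolding lift_height_def by (intro continuous_intros continuous_on_sep_weight) auto
qed

lemma lift_height_nonneg: "0 \<le> lift_height F j z"
  unfolding lift_height_def by (intro divide_nonneg_nonneg sum_nonneg sep_weight_nonneg) auto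

lemma lift_height_eq_0:
  assumes "\<And>H. H \<noteq> {} \<Longrightarrow> j \<notin> H \<Longrightarrow> F H \<Longrightarrow> \<not> sep H z"
  shows "lift_height F j z = 0"
proof -
  have "(\<Sum>H | H \<noteq> {} \<and> j \<notin> H \<and> F H. sep_weight H z) = 0"
    using assms by (intro sum.neutral ballI sep_weight_eq_0) auto
  then show ?thesis by (simp add: lift_height_def)
qed

lemma lift_height_pos:
  assumes "H \<noteq> {}" "j \<notin> H" "F H" "sep H z"
  shows "0 < lift_height F j z"
proof -
  have "0 < sep_weight H z" using assms sep_weight_pos_iff by blast
  also have "\<dots> \<le> (\<Sum>H | H \<noteq> {} \<and> j \<notin> H \<and> F H. sep_weight H z)"
    using assms by (intro member_le_sum[where f="\<lambda>H. sep_weight H z"]) (auto simp: sep_weight_nonneg)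
  finally show ?thesis unfolding lift_height_def by (intro divide_pos_pos add_pos_pos) auto
qed

text \<open>The smallest separated set \<open>H\<close> avoiding \<open>j\<close> survives when the \<open>j\<close>-th coordinate is raised to
  \<open>lift_height F j z\<close>, because every weight contributing to the sum is bounded by the coordinates
  in \<open>H\<close>.\<close>

lemma lift_height_less:
  assumes ex: "H0 \<noteq> {}" "j \<notin> H0" "F H0" "sep H0 z"
  obtains H where "H \<noteq> {}" "j \<notin> H" "F H" "sep H z" "\<And>i. i \<in> H \<Longrightarrow> lift_height F j z < \<bar>z $ i\<bar>"
proof -
  let ?A = "{H. H \<noteq> {} \<and> j \<notin> H \<and> F H}"
  obtain H where H: "H \<in> ?A \<and> sep H z" and min: "\<And>G. G \<in> ?A \<and> sep G z \<Longrightarrow> card H \<le> card G"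
    using ex_has_least_nat[of "\<lambda>H. H \<in> ?A \<and> sep H z" H0 card] ex by auto
  have "lift_height F j z < \<bar>z $ i\<bar>" if i: "i \<in> H" for i
  proof -
    have "sep_weight G z \<le> \<bar>z $ i\<bar>" if G: "G \<in> ?A" for G
    proof (cases "sep G z")
      case True
      have "H \<subseteq> G"
        using sep_linear[of G z H] True H min[of G] G card_seteq[of H G] by auto
      then show ?thesis using sep_weight_le i by blast
    qed (simp add: sep_weight_eq_0)
    then have "(\<Sum>G\<in>?A. sep_weight G z) \<le> real (card ?A) * \<bar>z $ i\<bar>"
      by (intro sum_bounded_above) auto
    also have "\<dots> \<le> 2 ^ CARD('a) * \<bar>z $ i\<bar>"
    proof (rule mult_right_mono)
      have "card ?A \<le> card (UNIV :: 'a set set)" by (rule card_mono) auto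
      then have "real (card ?A) \<le> real (2 ^ CARD('a))" by (auto simp: card_UNIV_set)
      then show "real (card ?A) \<le> 2 ^ CARD('a)" by simp
    qed simp
    also have "\<dots> < (2 ^ CARD('a) + 1) * \<bar>z $ i\<bar>"
      using H i by (auto simp: sep_def)
    finally show ?thesis unfolding lift_height_def
      by (subst pos_divide_less_eq) (auto simp: mult.commute intro: add_pos_pos)
  qed
  then show thesis using that[of H] H by auto
qed

section \<open>One folding step at the index \<open>j\<close>\<close>

context
  fixes F :: "'n::finite set \<Rightarrow> bool" and S J :: "'n set" and j :: 'n
  assumes j: "j \<notin> S"
begin

abbreviation (input) "whole \<equiv> Uset F \<inter> orthant S"
abbreviation (input) "whole_sub \<equiv> Uset (avoid F J) \<inter> orthant S"
text \<open>An open set that contains the points of \<open>Uset F\<close> with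
  \<open>z $ j = 0\<close>, because a separated set contains no index of a zero coordinate. It makes
  \<open>collar\<close> a relatively open neighbourhood of \<open>half\<close>, as excision
  requires.\<close>

abbreviation (input) "near \<equiv> Uset (avoid F {j})"
abbreviation (input) "collar \<equiv> whole \<inter> ({z. 0 < z $ j} \<union> near)"
abbreviation (input) "half \<equiv> Uset F \<inter> orthant (insert j S)"
abbreviation (input) "half_sub \<equiv> Uset (avoid F J) \<inter> orthant (insert j S)"
abbreviation (input) "next_sub \<equiv> Uset (avoid F (insert j J))"

lemma Uset_avoid_subset: "Uset (avoid F J') \<subseteq> Uset F"
  by (rule Uset_mono) (simp add: avoid_def)

lemma half_subset_collar: "half \<subseteq> collar"
proof
  fix z assume z: "z \<in> half"
  show "z \<in> collar"
  proof (cases "z $ j = 0")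
    case True
    obtain H where H: "H \<noteq> {}" "F H" "sep H z" using z by (auto simp: Uset_def)
    then have "j \<notin> H" using True by (auto simp: sep_def)
    then have "z \<in> near" using H unfolding Uset_def avoid_def by blast
    then show ?thesis using z by (auto simp: orthant_insert)
  qed (use z in \<open>auto simp: orthant_insert\<close>)
qed

text \<open>The two separated sets are comparable. If the one that does not contain \<open>J\<close>
  contains \<open>j\<close>, the other is a subset of it and meets both conditions.\<close>

lemma avoid_common:
  assumes "z \<in> near" "z \<in> Uset (avoid F J)"
  obtains H where "H \<noteq> {}" "j \<notin> H" "F H" "\<not> J \<subseteq> H" "sep H z"
proof -
  obtain G where G: "G \<noteq> {}" "F G" "\<not> J \<subseteq> G" "sep G z"
    using assms(2) by (auto simp: Uset_def avoid_def)
  obtain H where H: "H \<noteq> {}" "F H" "j \<notin> H" "sep H z"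
    using assms(1) by (auto simp: Uset_def avoid_def)
  show thesis
  proof (cases "j \<in> G")
    case True
    then have "H \<subseteq> G" using sep_linear[OF G(4) H(4)] H by blast
    then show thesis using that[of H] G H by blast
  qed (use that[of G] G in blast)
qed

text \<open>Points of the collar with negative \<open>j\<close>-th coordinate have a separated set
  without \<open>j\<close>. Shrinking that coordinate to zero keeps this set separated, and by
  \<open>avoid_common\<close> it can be chosen not to contain \<open>J\<close> for points of the
  subspace.\<close>

lemma incl_iso_collar:
  "incl_inj half half_sub collar (collar \<inter> whole_sub)" "incl_surj half half_sub collar (collar \<inter> whole_sub)"
proof -
  \<comment> \<open>The maximum leaves a nonnegative coordinate unchanged and scales a negative one
    by \<open>1 - t\<close>.\<close>
  define h where "h = (\<lambda>(t, z :: real ^ 'n). set_coord j (max (z $ j) ((1 - t) * z $ j)) z)"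
  have sub: "half \<subseteq> collar" "half_sub \<subseteq> collar \<inter> whole_sub" "half_sub \<subseteq> half" "collar \<inter> whole_sub \<subseteq> collar"
    using half_subset_collar Uset_avoid_subset by (auto simp: orthant_insert)
  have fix_pos: "h (t, z) = z" if "0 \<le> z $ j" "0 \<le> t" "t \<le> 1" for t z
  proof -
    have "(1 - t) * z $ j \<le> z $ j" using that mult_left_le_one_le[of "z $ j" "1 - t"] by auto
    then have "max (z $ j) ((1 - t) * z $ j) = z $ j" by simp
    then show ?thesis by (simp add: h_def)
  qed
  have shrink: "h (t, z) \<in> Uset G"
    if H: "H \<noteq> {}" "G H" "sep H z" "j \<notin> H" and z: "z $ j < 0" and t: "0 \<le> t" "t \<le> 1" for H G t z
  proof -
    have "(1 - t) * z $ j \<ge> z $ j" "(1 - t) * z $ j \<le> 0"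
      using z t mult_left_le_one_le[of "- (z $ j)" "1 - t"] by (auto simp: mult_le_0_iff)
    then have *: "max (z $ j) ((1 - t) * z $ j) = (1 - t) * z $ j" "\<bar>(1 - t) * z $ j\<bar> \<le> \<bar>z $ j\<bar>" by auto
    have "\<bar>(1 - t) * z $ j\<bar> < \<bar>z $ i\<bar>" if "i \<in> H" for i
      using *(2) H that by (auto simp: sep_def intro: order_le_less_trans)
    then show ?thesis using H Uset_set_coord[of H G z j] by (simp add: h_def *(1))
  qed
  have orth: "h (t, z) \<in> orthant S \<longleftrightarrow> z \<in> orthant S" for t z
    by (simp add: h_def set_coord_orthant j)
  have hV: "h (t, z) \<in> collar" if t: "0 \<le> t" "t \<le> 1" and z: "z \<in> collar" for t z
  proof (cases "0 \<le> z $ j")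
    case False
    then have "z \<in> near" using z by auto
    then obtain H where "H \<noteq> {}" "F H" "sep H z" "j \<notin> H" "avoid F {j} H"
      by (auto simp: Uset_def avoid_def)
    then have "h (t, z) \<in> Uset F" "h (t, z) \<in> near"
      using shrink[of H] False t by auto
    then show ?thesis using z orth by auto
  qed (use z fix_pos t in simp)
  have hB: "h (t, z) \<in> whole_sub" if t: "0 \<le> t" "t \<le> 1" and z: "z \<in> collar \<inter> whole_sub" for t z
  proof (cases "0 \<le> z $ j")
    case False
    then have "z \<in> near" "z \<in> Uset (avoid F J)" using z by auto
    then obtain H where "H \<noteq> {}" "j \<notin> H" "avoid F J H" "sep H z"
      using avoid_common unfolding avoid_def by metis
    then have "h (t, z) \<in> Uset (avoid F J)"
      using shrink[of H] False t by auto
    then show ?thesis using z orth by auto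
  qed (use z fix_pos t in simp)
  have h1: "0 \<le> h (1, z) $ j" for z by (simp add: h_def)
  have cont: "continuous_on ({0..1} \<times> collar) h"
    unfolding h_def case_prod_beta by (intro continuous_on_set_coord continuous_intros)
  have h0: "h (0, z) = z" for z by (simp add: h_def)
  have hP: "h (t, z) = z" if "z \<in> half" "0 \<le> t" "t \<le> 1" for t z
    using fix_pos that by (simp add: orthant_insert)
  have half: "h (1, z) \<in> half" if "z \<in> collar" for z
    using hV[of 1 z] that h1 by (simp add: orthant_insert)
  have half_sub: "h (1, z) \<in> half_sub" if "z \<in> collar \<inter> whole_sub" for z
    using hB[of 1 z] that h1 by (simp add: orthant_insert)
  show "incl_inj half half_sub collar (collar \<inter> whole_sub)" "incl_surj half half_sub collar (collar \<inter> whole_sub)"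
    by (rule incl_iso_deformation[OF sub cont h0];
        use hV hB hP half half_sub sub(3) in \<open>(simp; fail | auto; fail)\<close>)+
qed

lemma open_gt: "open {z :: real ^ 'n. 0 < z $ j}"
  by (intro open_Collect_less continuous_intros)

text \<open>Both sets are open in their union, so the part of \<open>whole_sub\<close> outside the
  collar can be excised.\<close>

lemma incl_iso_union:
  "incl_inj collar (collar \<inter> whole_sub) (collar \<union> whole_sub) whole_sub" "incl_surj collar (collar \<inter> whole_sub) (collar \<union> whole_sub) whole_sub"
proof -
  have "whole_sub = (collar \<union> whole_sub) \<inter> Uset (avoid F J)" by auto
  then have 1: "openin (top_of_set (collar \<union> whole_sub)) whole_sub"
    using openin_open_Int[OF open_Uset, of "collar \<union> whole_sub"] by metis
  have "open (Uset F \<inter> ({z. 0 < z $ j} \<union> near))"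
    by (intro open_Int open_Un open_Uset open_gt)
  moreover have "collar = (collar \<union> whole_sub) \<inter> (Uset F \<inter> ({z. 0 < z $ j} \<union> near))" by auto
  ultimately have "openin (top_of_set (collar \<union> whole_sub)) collar"
    using openin_open_Int[of _ "collar \<union> whole_sub"] by metis
  then have "closedin (top_of_set (collar \<union> whole_sub)) ((collar \<union> whole_sub) - collar)"
    by (intro closedin_diff) auto
  moreover have "(collar \<union> whole_sub) - collar = whole_sub - collar" by auto
  ultimately have 2: "closedin (top_of_set (collar \<union> whole_sub)) (whole_sub - collar)" by simp
  have "(collar \<union> whole_sub) - (whole_sub - collar) = collar" "whole_sub - (whole_sub - collar) = collar \<inter> whole_sub" by auto
  then show "incl_inj collar (collar \<inter> whole_sub) (collar \<union> whole_sub) whole_sub" "incl_surj collar (collar \<inter> whole_sub) (collar \<union> whole_sub) whole_sub"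
    using incl_iso_excision[OF 1 2] by auto
qed

text \<open>Replacing the \<open>j\<close>-th coordinate by its modulus retracts the pair onto its
  half. The half has the same homology as the first pair of the triple \<open>whole_sub\<close>,
  \<open>collar \<union> whole_sub\<close>, \<open>whole\<close>, so \<open>betti_split\<close>
  applies.\<close>

lemma betti_fold_split: "betti p whole whole_sub = betti p half half_sub + betti p whole (collar \<union> whole_sub)"
proof -
  have sub: "half \<subseteq> collar" "half_sub \<subseteq> collar \<inter> whole_sub" "half_sub \<subseteq> half" "whole_sub \<subseteq> collar \<union> whole_sub" "collar \<union> whole_sub \<subseteq> whole" "half_sub \<subseteq> whole_sub" "half \<subseteq> collar \<union> whole_sub"
    using half_subset_collar Uset_avoid_subset[of J] by (auto simp: orthant_insert)
  have 1: "betti p half half_sub = betti p collar (collar \<inter> whole_sub)"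
    using sub by (intro betti_incl_eq incl_iso_collar) auto
  have 2: "betti p collar (collar \<inter> whole_sub) = betti p (collar \<union> whole_sub) whole_sub"
    by (intro betti_incl_eq incl_iso_union) auto
  have surj: "incl_surj half half_sub (collar \<union> whole_sub) whole_sub"
    by (rule incl_surj_trans[OF incl_iso_collar(2) incl_iso_union(2)]) auto
  have "betti p whole whole_sub = betti p (collar \<union> whole_sub) whole_sub + betti p whole (collar \<union> whole_sub)"
  proof (rule betti_split[OF sub(4,5,7,6) surj])
    let ?\<rho> = "\<lambda>z. set_coord j \<bar>z $ j\<bar> z"
    show "continuous_on whole ?\<rho>" by (intro continuous_on_set_coord continuous_intros)
    show "?\<rho> ` whole \<subseteq> half" "?\<rho> ` whole_sub \<subseteq> half_sub"
      by (auto simp: Uset_set_coord_abs set_coord_orthant j orthant_insert)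
    show "?\<rho> z = z" if "z \<in> half" for z
      using that by (simp add: orthant_insert)
  qed
  then show ?thesis using 1 2 by simp
qed

text \<open>The closed half lies in the open set \<open>collar \<union> whole_sub\<close> and can be
  excised, leaving only points with negative \<open>j\<close>-th coordinate.\<close>

lemma betti_fold_excise:
  "betti p whole (collar \<union> whole_sub) = betti p (whole \<inter> {z. z $ j < 0}) (next_sub \<inter> orthant S \<inter> {z. z $ j < 0})"
proof -
  have "collar \<union> whole_sub \<subseteq> whole" using Uset_avoid_subset[of J] by auto
  have "open (Uset F \<inter> ({z. 0 < z $ j} \<union> near) \<union> Uset (avoid F J))"
    by (intro open_Int open_Un open_Uset open_gt)
  moreover have "collar \<union> whole_sub = whole \<inter> (Uset F \<inter> ({z. 0 < z $ j} \<union> near) \<union> Uset (avoid F J))"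
    using Uset_avoid_subset[of J] by auto
  ultimately have 1: "openin (top_of_set whole) (collar \<union> whole_sub)" by (metis openin_open_Int)
  have "closed {z :: real ^ 'n. 0 \<le> z $ j}" by (intro closed_Collect_le continuous_intros)
  then have "closedin (top_of_set whole) (whole \<inter> {z. 0 \<le> z $ j})" by (rule closedin_closed_Int)
  moreover have half: "half = whole \<inter> {z. 0 \<le> z $ j}" by (auto simp: orthant_insert)
  ultimately have 2: "closedin (top_of_set whole) half" by simp
  have 3: "half \<subseteq> collar \<union> whole_sub" using half_subset_collar by blast
  have XP: "whole - half = whole \<inter> {z. z $ j < 0}" by (auto simp: half)
  \<comment> \<open>Not containing \<open>insert j J\<close> means missing \<open>j\<close> or not
    containing \<open>J\<close>. This turns the remaining subspace into the one for the enlarged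
    index set.\<close>
  have "avoid F (insert j J) H \<longleftrightarrow> avoid F {j} H \<or> avoid F J H" for H by (auto simp: avoid_def)
  then have "next_sub = near \<union> Uset (avoid F J)" by (auto simp: Uset_def)
  then have VP: "(collar \<union> whole_sub) - half = next_sub \<inter> orthant S \<inter> {z. z $ j < 0}"
    using Uset_avoid_subset[of "{j}"] Uset_avoid_subset[of J] by (auto simp: orthant_insert)
  have "betti p (whole - half) ((collar \<union> whole_sub) - half) = betti p whole (collar \<union> whole_sub)"
    by (intro betti_incl_eq incl_iso_excision 1 2 3) auto
  then show ?thesis by (simp only: XP VP)
qed

lemma betti_fold_reflect:
  "betti p (whole \<inter> {z. z $ j < 0}) (next_sub \<inter> orthant S \<inter> {z. z $ j < 0})
    = betti p (whole \<inter> {z. 0 < z $ j}) (next_sub \<inter> orthant S \<inter> {z. 0 < z $ j})"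
proof (rule betti_involution[where r="\<lambda>z. set_coord j (- z $ j) z"])
  show "set_coord j (- set_coord j (- z $ j) z $ j) (set_coord j (- z $ j) z) = z" for z :: "real ^ 'n"
    by (simp add: vec_eq_iff)
  have "continuous_on UNIV (\<lambda>z. set_coord j (- z $ j) z)"
    by (intro continuous_on_set_coord continuous_intros)
  then show "continuous_on (whole \<inter> {z. z $ j < 0}) (\<lambda>z. set_coord j (- z $ j) z)"
    "continuous_on (whole \<inter> {z. 0 < z $ j}) (\<lambda>z. set_coord j (- z $ j) z)"
    by (auto intro: continuous_on_subset)
qed (auto simp: Uset_set_coord_abs set_coord_orthant j)

text \<open>The boundary hyperplane is put back by raising the \<open>j\<close>-th coordinate to at
  least \<open>t * lift_height F j z\<close>. This height is positive when \<open>F\<close> has a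
  nonempty separated set without \<open>j\<close>, in particular at the points of
  \<open>half\<close> on the hyperplane.\<close>

lemma betti_fold_lift:
  "betti p (whole \<inter> {z. 0 < z $ j}) (next_sub \<inter> orthant S \<inter> {z. 0 < z $ j})
    = betti p half (next_sub \<inter> orthant (insert j S))"
proof -
  let ?Q = "whole \<inter> {z. 0 < z $ j}" and ?BQ = "next_sub \<inter> orthant S \<inter> {z. 0 < z $ j}"
  let ?BP = "next_sub \<inter> orthant (insert j S)"
  define h where "h = (\<lambda>(t, z). set_coord j (max (z $ j) (t * lift_height F j z)) z)"
  have sub: "?Q \<subseteq> half" "?BQ \<subseteq> ?BP" "?BQ \<subseteq> ?Q" "?BP \<subseteq> half"
    using Uset_avoid_subset[of "insert j J"] by (auto simp: orthant_insert)
  have main: "h (t, z) \<in> Uset F \<and> (z \<in> next_sub \<longrightarrow> h (t, z) \<in> next_sub) \<and> (t = 1 \<longrightarrow> 0 < h (t, z) $ j)"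
    if z: "z \<in> half" and t: "0 \<le> t" "t \<le> 1" for t z
  \<comment> \<open>In the first case a separated set without \<open>j\<close> survives, which keeps
    the image in both \<open>Uset F\<close> and \<open>next_sub\<close>. In the second case the
    height is zero and \<open>z $ j\<close> is already positive, so the point does not move.\<close>
  proof (cases "\<exists>H. H \<noteq> {} \<and> j \<notin> H \<and> F H \<and> sep H z")
    case True
    then obtain H0 where H0: "H0 \<noteq> {}" "j \<notin> H0" "F H0" "sep H0 z" by blast
    obtain H where H: "H \<noteq> {}" "j \<notin> H" "F H" "sep H z"
        "\<And>i. i \<in> H \<Longrightarrow> lift_height F j z < \<bar>z $ i\<bar>"
      using lift_height_less[of H0 j F z] H0 by metis
    have "\<bar>max (z $ j) (t * lift_height F j z)\<bar> < \<bar>z $ i\<bar>" if "i \<in> H" for i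
    proof -
      have "t * lift_height F j z \<le> lift_height F j z" "0 \<le> t * lift_height F j z"
        using t lift_height_nonneg[of F j z] by (auto simp: mult_left_le_one_le)
      moreover have "\<bar>z $ j\<bar> < \<bar>z $ i\<bar>" using H that by (auto simp: sep_def)
      ultimately show ?thesis using H(5)[OF that] by auto
    qed
    then have "h (t, z) \<in> Uset (avoid F {j})" "avoid F {j} H"
      using H Uset_set_coord[of H "avoid F {j}" z j] by (auto simp: h_def avoid_def)
    moreover have "Uset (avoid F {j}) \<subseteq> next_sub" by (rule Uset_mono) (auto simp: avoid_def)
    ultimately have "h (t, z) \<in> next_sub" by blast
    moreover have "0 < h (1, z) $ j" using lift_height_pos[of H j F z] H by (simp add: h_def)
    ultimately show ?thesis using Uset_avoid_subset[of "insert j J"] by blast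
  next
    case False
    have zj: "0 \<le> z $ j" using z by (simp add: orthant_insert)
    have "lift_height F j z = 0" using False by (intro lift_height_eq_0) blast
    then have hz: "h (t, z) = z" using zj by (simp add: h_def)
    obtain H where "H \<noteq> {}" "F H" "sep H z" using z by (auto simp: Uset_def)
    then have "z $ j \<noteq> 0" using False by (auto simp: sep_def)
    then show ?thesis using zj hz z by auto
  qed
  have orth: "h (t, z) \<in> orthant S \<longleftrightarrow> z \<in> orthant S" for t z
    by (simp add: h_def set_coord_orthant j)
  have up: "z $ j \<le> h (t, z) $ j" for t z by (simp add: h_def)
  have cont: "continuous_on ({0..1} \<times> half) h"
    unfolding h_def case_prod_beta
    by (intro continuous_on_set_coord continuous_intros
        continuous_on_compose2[OF continuous_on_lift_height[of UNIV]]) auto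
  have h0: "h (0, z) = z" if "z \<in> half" for z
  proof -
    have "max (z $ j) 0 = z $ j" using that by (simp add: orthant_insert)
    then show ?thesis by (simp add: h_def)
  qed
  have hP: "h (t, z) \<in> half" if "z \<in> half" "0 \<le> t" "t \<le> 1" for t z
    using main[OF that] that orth order_trans[OF _ up] by (simp add: orthant_insert)
  have hBP: "h (t, z) \<in> ?BP" if "z \<in> ?BP" "0 \<le> t" "t \<le> 1" for t z
    using main[of z t] that orth order_trans[OF _ up] sub(4) by (auto simp: orthant_insert)
  have hQ: "h (t, z) \<in> ?Q" if "z \<in> ?Q" "0 \<le> t" "t \<le> 1" for t z
    using hP[of z t] that order_less_le_trans[OF _ up, of 0 z t] sub(1) by (auto simp: orthant_insert)
  have hBQ: "h (t, z) \<in> ?BQ" if "z \<in> ?BQ" "0 \<le> t" "t \<le> 1" for t z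
    using hBP[of z t] that order_less_le_trans[OF _ up, of 0 z t] sub(2) by (auto simp: orthant_insert)
  have h1: "h (1, z) \<in> ?Q" if "z \<in> half" for z
    using main[of z 1] hP[of z 1] that by (auto simp: orthant_insert)
  have hB1: "h (1, z) \<in> ?BQ" if "z \<in> ?BP" for z
    using main[of z 1] hBP[of z 1] that sub(4) by (auto simp: orthant_insert)
  have "incl_inj ?Q ?BQ half ?BP" "incl_surj ?Q ?BQ half ?BP"
    by (rule incl_iso_deformation[OF sub cont]; (rule h0 hP hBP hQ hBQ h1 hB1; assumption))+
  then show ?thesis using sub by (intro betti_incl_eq) auto
qed

text \<open>The nonnegative half gives the first summand; the rest of the homology, concentrated on
  the negative half, is reflected and lifted to give the second.\<close>

theorem betti_fold:
  "betti p (Uset F \<inter> orthant S) (Uset (avoid F J) \<inter> orthant S)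
    = betti p (Uset F \<inter> orthant (insert j S)) (Uset (avoid F J) \<inter> orthant (insert j S))
    + betti p (Uset F \<inter> orthant (insert j S)) (Uset (avoid F (insert j J)) \<inter> orthant (insert j S))"
  using betti_fold_split betti_fold_excise betti_fold_reflect betti_fold_lift by simp

end

section \<open>The realization of the complex\<close>

text \<open>Between the smallest coordinate \<open>i\<close> in \<open>H\<close> and the largest
  \<open>j\<close> outside there is a strict gap, which some \<open>A x\<close> with positive
  coefficient must produce by containing \<open>i\<close> but not \<open>j\<close>. Along a chain
  such an \<open>A x\<close> strictly separates its coordinates, which forces
  \<open>A x = H\<close>.\<close>

lemma sep_of_chain_combination:
  fixes z :: "real ^ 'n::finite" and c :: "'a \<Rightarrow> real" and A :: "'a \<Rightarrow> 'n set"
  assumes I: "finite I"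
    and chain: "\<And>x y. x \<in> I \<Longrightarrow> y \<in> I \<Longrightarrow> A x \<subseteq> A y \<or> A y \<subseteq> A x"
    and c: "\<And>x. x \<in> I \<Longrightarrow> 0 \<le> c x"
    and z: "\<And>i. z $ i = (\<Sum>x\<in>I. if i \<in> A x then c x else 0)"
    and H: "H \<noteq> {}" "sep H z"
  shows "\<exists>x\<in>I. A x = H"
proof -
  have z0: "0 \<le> z $ i" for i unfolding z using c by (intro sum_nonneg) auto
  have strict: "z $ k < z $ i" if x: "x \<in> I" "0 < c x" "i \<in> A x" "k \<notin> A x" for i k x
    unfolding z
  proof (rule sum_strict_mono_ex1[OF I])
    show "\<forall>y\<in>I. (if k \<in> A y then c y else 0) \<le> (if i \<in> A y then c y else 0)"
    proof
      fix y assume y: "y \<in> I"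
      have "k \<in> A y \<Longrightarrow> i \<in> A y" using chain[OF x(1) y] x by blast
      then show "(if k \<in> A y then c y else 0) \<le> (if i \<in> A y then c y else 0)"
        using c[OF y] by auto
    qed
    show "\<exists>y\<in>I. (if k \<in> A y then c y else 0) < (if i \<in> A y then c y else 0)"
      using x by (intro bexI[of _ x]) auto
  qed
  obtain i where i: "i \<in> H" "\<And>k. k \<in> H \<Longrightarrow> z $ i \<le> z $ k"
    using ex_is_arg_min_if_finite[of H "\<lambda>k. z $ k"] H by (auto simp: is_arg_min_linorder)
  show ?thesis
  proof (cases "- H = {}")
    case True
    have "\<exists>x\<in>I. 0 < c x \<and> i \<in> A x"
    proof (rule ccontr)
      assume "\<not> ?thesis"
      then have "z $ i \<le> 0" unfolding z by (intro sum_nonpos) (auto simp: not_less)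
      then show False using H i(1) z0[of i] by (auto simp: sep_def)
    qed
    then obtain x where x: "x \<in> I" "0 < c x" "i \<in> A x" by blast
    have "A x = H"
    proof
      show "H \<subseteq> A x" using strict[OF x] i(2) by (meson not_less subsetI)
      show "A x \<subseteq> H" using True by blast
    qed
    then show ?thesis using x by blast
  next
    case False
    obtain j where j: "j \<notin> H" "\<And>k. k \<notin> H \<Longrightarrow> z $ k \<le> z $ j"
      using ex_is_arg_min_if_finite[of "- H" "\<lambda>k. - z $ k"] False
      by (auto simp: is_arg_min_linorder)
    have "\<bar>z $ j\<bar> < \<bar>z $ i\<bar>" using H i(1) j(1) unfolding sep_def by blast
    then have ji: "z $ j < z $ i" using z0[of i] z0[of j] by simp
    have "\<exists>x\<in>I. 0 < c x \<and> i \<in> A x \<and> j \<notin> A x"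
    proof (rule ccontr)
      assume no: "\<not> ?thesis"
      have "z $ i \<le> z $ j" unfolding z using no c by (intro sum_mono) force
      then show False using ji by simp
    qed
    then obtain x where x: "x \<in> I" "0 < c x" "i \<in> A x" "j \<notin> A x" by blast
    have "A x = H"
    proof
      show "H \<subseteq> A x" using strict[OF x(1-3)] i(2) by (meson not_less subsetI)
      show "A x \<subseteq> H" using strict[OF x(1,2) _ x(4)] j(2) by (meson not_less subsetI)
    qed
    then show ?thesis using x by blast
  qed
qed

text \<open>Peel off the least nonzero coordinate, times the indicator vector of the support.\<close>

lemma sep_decomposition:
  fixes z :: "real ^ 'n::finite"
  assumes "z \<in> orthant UNIV"
  shows "\<exists>c. (\<forall>H. 0 \<le> c H) \<and> (\<forall>H. 0 < c H \<longrightarrow> H \<noteq> {} \<and> sep H z) \<and>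
    (\<forall>i. z $ i = (\<Sum>H\<in>UNIV. if i \<in> H then c H else 0))"
  using assms
proof (induction "card {i. z $ i \<noteq> 0}" arbitrary: z rule: less_induct)
  case less
  let ?H = "{i. z $ i \<noteq> 0}"
  show ?case
  proof (cases "?H = {}")
    case True
    then show ?thesis by (intro exI[of _ "\<lambda>_. 0"]) auto
  next
    case False
    obtain m where m: "m \<in> ?H" "\<And>k. k \<in> ?H \<Longrightarrow> z $ m \<le> z $ k"
      using ex_is_arg_min_if_finite[of ?H "\<lambda>k. z $ k"] False by (auto simp: is_arg_min_linorder)
    define w where "w = (\<chi> i. if z $ i \<noteq> 0 then z $ i - z $ m else 0)"
    have pos: "0 \<le> z $ i" for i using less.prems by (simp add: orthant_def)
    have w: "w \<in> orthant UNIV" using m by (auto simp: orthant_def w_def)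
    have "{i. w $ i \<noteq> 0} \<subset> ?H" using m(1) by (auto simp: w_def)
    then have "card {i. w $ i \<noteq> 0} < card ?H" by (intro psubset_card_mono) auto
    from less.hyps[OF this w] obtain c where c: "\<And>H. 0 \<le> c H"
      "\<And>H. 0 < c H \<Longrightarrow> H \<noteq> {} \<and> sep H w" "\<And>i. w $ i = (\<Sum>H\<in>UNIV. if i \<in> H then c H else 0)"
      by auto
    \<comment> \<open>The same constant \<open>z $ m\<close> was subtracted from all nonzero
      coordinates, so their order is unchanged.\<close>
    have sep: "sep G z" if G: "sep G w" for G
      unfolding sep_def
    proof (intro ballI conjI)
      fix i assume i: "i \<in> G"
      then have wi: "w $ i \<noteq> 0" using G by (simp add: sep_def)
      then show zi: "z $ i \<noteq> 0" by (auto simp: w_def)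
      fix k assume "k \<in> - G"
      then have "\<bar>w $ k\<bar> < \<bar>w $ i\<bar>" using G i by (simp add: sep_def)
      then have "w $ k < w $ i" using w by (simp add: orthant_def)
      moreover have "w $ i = z $ i - z $ m" using zi by (simp add: w_def)
      moreover have "z $ k = 0 \<or> w $ k = z $ k - z $ m" by (simp add: w_def)
      ultimately have "z $ k < z $ i" using zi pos[of i] by linarith
      then show "\<bar>z $ k\<bar> < \<bar>z $ i\<bar>" using pos[of k] by simp
    qed
    let ?c = "\<lambda>H. c H + (if H = ?H then z $ m else 0)"
    have "z $ i = (\<Sum>H\<in>UNIV. if i \<in> H then ?c H else 0)" for i
    proof -
      have "(\<Sum>H\<in>UNIV. if i \<in> H then ?c H else 0)
        = (\<Sum>H\<in>UNIV. (if i \<in> H then c H else 0) + (if H = ?H then (if i \<in> ?H then z $ m else 0) else 0))"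
        by (intro sum.cong) auto
      also have "\<dots> = w $ i + (if i \<in> ?H then z $ m else 0)"
        by (simp add: sum.distrib c(3))
      also have "\<dots> = z $ i" by (simp add: w_def)
      finally show ?thesis by simp
    qed
    moreover have "0 \<le> ?c H" for H using c(1)[of H] pos[of m] by auto
    moreover have "H \<noteq> {} \<and> sep H z" if H: "0 < ?c H" for H
    proof (cases "H = ?H")
      case True
      then show ?thesis using False sep_support by simp
    next
      case False
      then show ?thesis using H c(2)[of H] sep by simp
    qed
    ultimately show ?thesis by (intro exI[of _ ?c]) blast
  qed
qed

lemma barycenter_nth: "barycenter h $ i = (if h i then 1 / real (card {j. h j}) else 0)"
proof -
  have "(\<Sum>j\<in>{j. h j}. axis j (1::real)) $ i = (\<Sum>j\<in>{j. h j}. if j = i then 1 else 0)"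
    by (simp add: axis_def)
  then show ?thesis by (simp add: barycenter_def)
qed

text \<open>A barycenter is an indicator vector divided by the size of its support, so convex
  combinations of barycenters along a chain are combinations of indicator vectors of nested sets.
  The two preceding decomposition lemmas give the two inclusions.\<close>

lemma realization_Sigma_complex:
  fixes f :: "('n::finite \<Rightarrow> bool) \<Rightarrow> bool"
  defines "F \<equiv> \<lambda>H. f (\<lambda>i. i \<in> H)"
  shows "realization (Sigma_complex f) = Cset F \<inter> std_simplex"
proof (intro equalityI subsetI)
  fix z assume "z \<in> realization (Sigma_complex f)"
  then obtain C where C: "C \<in> Sigma_complex f" "z \<in> convex hull (barycenter ` C)"
    by (auto simp: realization_def)
  have chain: "h \<le> g \<or> g \<le> h" if "h \<in> C" "g \<in> C" for h g
    using C that by (auto simp: Sigma_complex_def barycentric_subdivision_def)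
  have fC: "f h" "h \<noteq> (\<lambda>_. False)" if "h \<in> C" for h
    using C that by (auto simp: Sigma_complex_def barycentric_subdivision_def)
  \<comment> \<open>A subset on which \<open>barycenter\<close> is injective lets the convex
    coefficients be indexed by the vectors themselves.\<close>
  obtain D where D: "D \<subseteq> C" "inj_on barycenter D" "barycenter ` C = barycenter ` D"
    using subset_image_inj[of "barycenter ` C" barycenter C] by auto
  have "finite D" by simp
  then obtain u where u: "\<And>h. h \<in> D \<Longrightarrow> 0 \<le> u (barycenter h)"
    "(\<Sum>h\<in>D. u (barycenter h)) = 1" "z = (\<Sum>h\<in>D. u (barycenter h) *\<^sub>R barycenter h)"
    using C(2) unfolding D(3) convex_hull_finite[OF finite_imageI[OF \<open>finite D\<close>]]
    by (auto simp: sum.reindex[OF D(2)])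
  define c where "c h = u (barycenter h) / real (card {j. h j})" for h
  have zi: "z $ i = (\<Sum>h\<in>D. if i \<in> {j. h j} then c h else 0)" for i
    unfolding u(3) by (auto simp: barycenter_nth c_def intro!: sum.cong)
  have c0: "0 \<le> c h" if "h \<in> D" for h using u that by (simp add: c_def)
  have cpos: "0 < card {j. h j}" if "h \<in> D" for h
    using fC(2)[of h] D that by (auto simp: card_gt_0_iff fun_eq_iff)
  have "(\<Sum>i\<in>UNIV. z $ i) = (\<Sum>h\<in>D. \<Sum>i\<in>UNIV. if i \<in> {j. h j} then c h else 0)"
    unfolding zi by (rule sum.swap)
  also have "\<dots> = (\<Sum>h\<in>D. u (barycenter h))"
  proof (rule sum.cong)
    fix h assume "h \<in> D"
    then show "(\<Sum>i\<in>UNIV. if i \<in> {j. h j} then c h else 0) = u (barycenter h)"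
      using cpos[of h] by (auto simp: c_def sum.If_cases card_gt_0_iff)
  qed simp
  finally have sum1: "(\<Sum>i\<in>UNIV. z $ i) = 1" using u by simp
  have z0: "0 \<le> z $ i" for i unfolding zi using c0 by (intro sum_nonneg) auto
  have "z \<noteq> 0" using sum1 by auto
  moreover have "F H" if H: "H \<noteq> {}" "sep H z" for H
  proof -
    have "\<exists>h\<in>D. {j. h j} = H"
      by (rule sep_of_chain_combination[OF \<open>finite D\<close> _ c0 zi H])
        (use chain D in \<open>force simp: le_fun_def\<close>)
    then show ?thesis using fC D by (auto simp: F_def)
  qed
  ultimately show "z \<in> Cset F \<inter> std_simplex"
    using sum1 z0 by (auto simp: Cset_def std_simplex_def)
next
  fix z assume z: "z \<in> Cset F \<inter> std_simplex"
  then have z1: "(\<Sum>i\<in>UNIV. z $ i) = 1" and zF: "\<And>H. H \<noteq> {} \<Longrightarrow> sep H z \<Longrightarrow> F H" and z0: "z \<noteq> 0"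
    by (auto simp: Cset_def std_simplex_def)
  obtain c where c: "\<And>H. 0 \<le> c H" "\<And>H. 0 < c H \<Longrightarrow> H \<noteq> {} \<and> sep H z"
    "\<And>i. z $ i = (\<Sum>H\<in>UNIV. if i \<in> H then c H else 0)"
    using sep_decomposition[of z] z by (auto simp: std_simplex_def orthant_def)
  \<comment> \<open>All nonempty separated sets are taken, including those with coefficient zero;
    they form a chain inside \<open>F\<close>.\<close>
  define I where "I = {H. H \<noteq> {} \<and> sep H z}"
  let ?C = "(\<lambda>H i. i \<in> H) ` I"
  have c0: "c H = 0" if "H \<notin> I" for H using c(1,2)[of H] that by (auto simp: less_le I_def)
  have "?C \<in> Sigma_complex f"
  proof -
    have "{i. z $ i \<noteq> 0} \<in> I" using sep_support support_nonempty[OF z0] by (simp add: I_def)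
    then have "?C \<noteq> {}" by blast
    moreover have "(\<lambda>_. False) \<notin> ?C" by (auto simp: fun_eq_iff I_def)
    moreover have "g \<le> h \<or> h \<le> g" if "g \<in> ?C" "h \<in> ?C" for g h
    proof -
      obtain G H where "g = (\<lambda>i. i \<in> G)" "h = (\<lambda>i. i \<in> H)" "sep G z" "sep H z"
        using \<open>g \<in> ?C\<close> \<open>h \<in> ?C\<close> by (auto simp: I_def)
      then show ?thesis using sep_linear[of G z H] by (auto simp: le_fun_def)
    qed
    moreover have "f (\<lambda>i. i \<in> H)" if "H \<in> I" for H
      using zF[of H] that by (simp add: I_def F_def)
    then have "?C \<subseteq> {h. f h}" by blast
    ultimately show ?thesis by (simp add: Sigma_complex_def barycentric_subdivision_def)
  qed
  moreover have "z \<in> convex hull (barycenter ` ?C)"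
  proof -
    have "z = (\<Sum>H\<in>I. (c H * real (card H)) *\<^sub>R barycenter (\<lambda>i. i \<in> H))"
    proof -
      have "(\<Sum>H\<in>I. (c H * real (card H)) *\<^sub>R barycenter (\<lambda>i. i \<in> H)) $ i = z $ i" for i
      proof -
        have "(\<Sum>H\<in>I. (c H * real (card H)) *\<^sub>R barycenter (\<lambda>i. i \<in> H)) $ i
          = (\<Sum>H\<in>I. if i \<in> H then c H else 0)"
          by (auto simp: barycenter_nth card_gt_0_iff intro!: sum.cong)
        also have "\<dots> = (\<Sum>H\<in>UNIV. if i \<in> H then c H else 0)"
          using c0 by (intro sum.mono_neutral_left) auto
        finally show ?thesis using c(3) by simp
      qed
      then show ?thesis by (simp add: vec_eq_iff)
    qed
    also have "\<dots> \<in> convex hull (barycenter ` ?C)"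
    proof (rule convex_sum)
      \<comment> \<open>Double counting: each \<open>H\<close> contributes \<open>c H\<close> once
        per index in \<open>H\<close>, and summing over the indices gives the coordinate sum of
        \<open>z\<close>.\<close>
      have "(\<Sum>H\<in>I. c H * real (card H)) = (\<Sum>H\<in>UNIV. c H * real (card H))"
        using c0 by (intro sum.mono_neutral_left) auto
      also have "\<dots> = (\<Sum>H\<in>UNIV. \<Sum>i\<in>UNIV. if i \<in> H then c H else 0)"
        by (intro sum.cong) (auto simp: sum.If_cases)
      also have "\<dots> = (\<Sum>i\<in>UNIV. \<Sum>H\<in>UNIV. if i \<in> H then c H else 0)" by (rule sum.swap)
      also have "\<dots> = 1" using z1 c(3) by simp
      finally show "(\<Sum>H\<in>I. c H * real (card H)) = 1" .
    qed (use c(1) in \<open>auto intro: hull_inc\<close>)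
    finally show ?thesis .
  qed
  ultimately show "z \<in> realization (Sigma_complex f)" by (auto simp: realization_def)
qed

text \<open>A zero coordinate with index in \<open>J\<close> prevents every separated set from
  containing \<open>J\<close>. Conversely, the support is separated, so if it does not contain
  \<open>J\<close> some coordinate in \<open>J\<close> vanishes.\<close>

lemma Cset_facets:
  "Cset F \<inter> std_simplex \<inter> facets J = Cset (avoid F J) \<inter> std_simplex"
proof (intro equalityI subsetI)
  fix z assume z: "z \<in> Cset F \<inter> std_simplex \<inter> facets J"
  then obtain j where j: "j \<in> J" "z $ j = 0" by (auto simp: facets_def facet_def)
  have "\<not> J \<subseteq> H" if "sep H z" for H using j that by (auto simp: sep_def)
  then show "z \<in> Cset (avoid F J) \<inter> std_simplex" using z by (auto simp: Cset_def avoid_def)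
next
  fix z assume z: "z \<in> Cset (avoid F J) \<inter> std_simplex"
  then have "avoid F J {i. z $ i \<noteq> 0}"
    using sep_support[of z] support_nonempty[of z] by (simp add: Cset_def del: Collect_empty_eq)
  then obtain j where "j \<in> J" "z $ j = 0" by (auto simp: avoid_def)
  then show "z \<in> Cset F \<inter> std_simplex \<inter> facets J"
    using z by (auto simp: Cset_def avoid_def facets_def facet_def)
qed

section \<open>Folding all coordinates and summing over the degrees\<close>

text \<open>Each folding at a new index \<open>j\<close> replaces the summand of \<open>J\<close> by
  those of \<open>J\<close> and \<open>insert j J\<close>, which together run through the subsets of
  \<open>insert j S\<close>.\<close>

lemma betti_fold_all:
  assumes "finite S"
  shows "betti p (Uset F) {} = (\<Sum>J\<in>Pow S. betti p (Uset F \<inter> orthant S) (Uset (avoid F J) \<inter> orthant S))"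
  using assms
proof (induction S)
  case empty
  have "Uset (avoid F {}) = {}" by (auto simp: Uset_def avoid_def)
  then show ?case by (simp add: orthant_def)
next
  case (insert j S)
  let ?b = "\<lambda>J. betti p (Uset F \<inter> orthant (insert j S)) (Uset (avoid F J) \<inter> orthant (insert j S))"
  have inj: "inj_on (insert j) (Pow S)"
    using insert.hyps by (intro inj_onI) (metis PowD insert_ident subsetD)
  have "betti p (Uset F) {} = (\<Sum>J\<in>Pow S. ?b J + ?b (insert j J))"
    unfolding insert.IH by (intro sum.cong refl betti_fold insert.hyps)
  also have "\<dots> = (\<Sum>J\<in>Pow S. ?b J) + (\<Sum>J\<in>insert j ` Pow S. ?b J)"
    by (simp add: sum.distrib sum.reindex[OF inj])
  also have "\<dots> = (\<Sum>J\<in>Pow S \<union> insert j ` Pow S. ?b J)"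
    using insert.hyps by (intro sum.union_disjoint[symmetric]) auto
  finally show ?case by (simp add: Pow_insert)
qed

lemma suminf_sum_enat:
  fixes g :: "'a \<Rightarrow> nat \<Rightarrow> enat"
  shows "suminf (\<lambda>i. \<Sum>x\<in>A. g x i) = (\<Sum>x\<in>A. suminf (g x))"
  by (rule suminf_sum) simp

theorem theorem4p1:
  fixes f :: "('n::finite \<Rightarrow> bool) \<Rightarrow> bool"
  shows "gamma f =
    (\<Sum>J\<in>(UNIV :: 'n set set).
       total_betti (realization (Sigma_complex f)) (realization (Sigma_complex f) \<inter> facets J))"
proof -
  define F where "F = (\<lambda>H. f (\<lambda>i. i \<in> H))"
  have R: "realization (Sigma_complex f) = Cset F \<inter> std_simplex"
    unfolding F_def by (rule realization_Sigma_complex)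
  have avoid: "avoid F J H \<Longrightarrow> F H" for J H by (simp add: avoid_def)
  \<comment> \<open>The identity holds in each degree separately; only afterwards are the degrees
    summed.\<close>
  have "betti p (Zset f) {} = (\<Sum>J\<in>UNIV. betti p (realization (Sigma_complex f))
    (realization (Sigma_complex f) \<inter> facets J))" for p
  proof -
    have "betti p (Zset f) {} = betti p (Uset F) {}" unfolding F_def by (rule betti_Zset)
    also have "\<dots> = (\<Sum>J\<in>UNIV. betti p (Uset F \<inter> orthant UNIV) (Uset (avoid F J) \<inter> orthant UNIV))"
      using betti_fold_all[of UNIV p F] by simp
    also have "\<dots> = (\<Sum>J\<in>UNIV. betti p (Cset F \<inter> std_simplex) (Cset (avoid F J) \<inter> std_simplex))"
      by (intro sum.cong refl) (simp only: betti_Uset_Cset[OF avoid] betti_Cset_simplex[OF avoid])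
    finally show ?thesis by (simp only: R Cset_facets)
  qed
  then show ?thesis
    unfolding gamma_def total_betti_def betti_def[symmetric] by (simp add: suminf_sum_enat)
qed

end
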